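(* Let $W$ be a simple spherical polygon in general position. Then, for every $\xi\in S^2$ admissible for $W$, $|d(W,\xi)|\le |i(W,\xi)|$ and $d(W,\xi)-i(W,\xi)$ is even. Conversely, given any two integers $i,d$ with $i<1$, $|i|\ge|d|$ and $d-i$ even, there exist a simple spherical polygon $W$ and an appropriate choice of $\xi\in S^2$ such that $i(W,\xi)=i$ and $d(W,\xi)=d$.
   Context: A spherical polygon $W=(w_1,\dots,w_n)$, $w_i\in S^2$, indices mod $n$, is the closed oriented polygon whose edges are the shortest great circle arcs $w_iw_{i+1}$; all edges have length less than $\pi$ and $w_{i+1}\neq w_i$. It is simple if it has no self-intersections, and in general position if no three vertices lie on a common great circle. The polar polygon $W'=(w'_1,\dots,w'_n)$ is the spherical polygon with vertices $w_i'=\frac{w_i\times w_{i+1}}{\|w_i\times w_{i+1}\|}$, consecutive vertices being joined by shortest great circle arcs. $\xi\in S^2$ is admissible for $W$ if, for all $i$, $\langle\xi,w_i\rangle=0$ implies $\langle\xi,w_{i-1}\rangle\langle\xi,w_{i+1}\rangle<0$. Critical point index: $i(W,\xi)=1-M$, where $M$ is the number of indices $i$ with $\langle\xi,w_i\rangle>0$ and $\langle\xi,w_{i-1}\rangle\le 0$ (so $M$ is half the number of intersections of $W$ with the great circle $S(\xi)$ with pole $\xi$). Normal degree: let $\gamma$ be any oriented great circle arc (half great circle) from $\xi$ to $-\xi$ meeting no vertex of $W'$. Then $d(W,\xi):=\sum_{i=1}^n d(w'_iw'_{i+1},\gamma)$, where $d(w'_iw'_{i+1},\gamma)=\frac{\langle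 w'_i\times w'_{i+1},\xi\rangle}{|\langle w'_i\times w'_{i+1},\xi\rangle|}$ if the edge $w_i'w_{i+1}'$ intersects $\gamma$, and $0$ otherwise; this does not depend on the choice of $\gamma$. *)

theory Defs
  imports "HOL-Analysis.Analysis"
begin

text \<open>A polygon is given by the list of its vertices in \<open>\<real>\<^sup>3\<close>; \<open>vtx W i\<close> is the vertex
  with index \<open>i\<close>, where \<open>i\<close> is an integer read modulo the number of vertices.\<close>

definition vtx :: "(real^3) list \<Rightarrow> int \<Rightarrow> real^3" where
  "vtx W i = W ! nat (i mod int (length W))"

text \<open>The shortest great circle arc between two non-antipodal points: the points of the
  sphere in the convex cone spanned by the end points.\<close>

definition great_arc :: "real^3 \<Rightarrow> real^3 \<Rightarrow> (real^3) set" where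
  "great_arc a b = {x \<in> sphere 0 1. \<exists>s\<ge>0. \<exists>t\<ge>0. x = s *\<^sub>R a + t *\<^sub>R b}"

text \<open>For unit vectors \<open>a\<close>, \<open>b\<close> the shortest arc has length less than \<open>pi\<close>, and is unique,
  exactly when \<open>b \<noteq> - a\<close>.\<close>

definition spherical_polygon :: "(real^3) list \<Rightarrow> bool" where
  "spherical_polygon W \<longleftrightarrow> 3 \<le> length W \<and> set W \<subseteq> sphere 0 1 \<and>
     (\<forall>i. vtx W (i + 1) \<noteq> vtx W i \<and> vtx W (i + 1) \<noteq> - vtx W i)"

text \<open>The edges without their final end points partition the parameter circle of the closed
  curve, so their pairwise disjointness says that this curve is injective.\<close>

definition simple_polygon :: "(real^3) list \<Rightarrow> bool" where
  "simple_polygon W \<longleftrightarrow>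
     (\<forall>i\<in>{0..<int (length W)}. \<forall>j\<in>{0..<int (length W)}. i \<noteq> j \<longrightarrow>
        (great_arc (vtx W i) (vtx W (i + 1)) - {vtx W (i + 1)}) \<inter>
        (great_arc (vtx W j) (vtx W (j + 1)) - {vtx W (j + 1)}) = {})"

definition great_circle :: "real^3 \<Rightarrow> (real^3) set" where
  "great_circle \<xi> = {x \<in> sphere 0 1. \<xi> \<bullet> x = 0}"

definition general_position :: "(real^3) list \<Rightarrow> bool" where
  "general_position W \<longleftrightarrow>
     (\<forall>i j k. i < j \<and> j < k \<and> k < length W \<longrightarrow>
        \<not> (\<exists>\<xi>\<in>sphere 0 1. {W ! i, W ! j, W ! k} \<subseteq> great_circle \<xi>))"

definition polar_polygon :: "(real^3) list \<Rightarrow> (real^3) list" where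
  "polar_polygon W =
     map (\<lambda>i. cross3 (vtx W i) (vtx W (i + 1)) /\<^sub>R norm (cross3 (vtx W i) (vtx W (i + 1))))
       [0..int (length W) - 1]"

definition admissible :: "(real^3) list \<Rightarrow> real^3 \<Rightarrow> bool" where
  "admissible W \<xi> \<longleftrightarrow>
     (\<forall>i. \<xi> \<bullet> vtx W i = 0 \<longrightarrow> (\<xi> \<bullet> vtx W (i - 1)) * (\<xi> \<bullet> vtx W (i + 1)) < 0)"

definition critical_index :: "(real^3) list \<Rightarrow> real^3 \<Rightarrow> int" where
  "critical_index W \<xi> =
     1 - int (card {i \<in> {0..<int (length W)}. \<xi> \<bullet> vtx W i > 0 \<and> \<xi> \<bullet> vtx W (i - 1) \<le> 0})"

text \<open>The great circle arcs from \<open>\<xi>\<close> to \<open>-\<xi>\<close>, as point sets; their orientation is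
  determined by \<open>\<xi>\<close>.\<close>

definition half_great_circles :: "real^3 \<Rightarrow> (real^3) set set" where
  "half_great_circles \<xi> =
     {(\<lambda>t. cos t *\<^sub>R \<xi> + sin t *\<^sub>R u) ` {0..pi} | u. u \<in> sphere 0 1 \<and> \<xi> \<bullet> u = 0}"

text \<open>The quotient \<open>x / \<bar>x\<bar>\<close> is \<open>sgn x\<close>; the floor only turns this real number into an
  integer.\<close>

definition crossing_sign :: "real^3 \<Rightarrow> real^3 \<Rightarrow> real^3 \<Rightarrow> (real^3) set \<Rightarrow> int" where
  "crossing_sign a b \<xi> \<gamma> =
     (if great_arc a b \<inter> \<gamma> \<noteq> {} then \<lfloor>sgn (cross3 a b \<bullet> \<xi>)\<rfloor> else 0)"

definition crossing_sum :: "(real^3) list \<Rightarrow> real^3 \<Rightarrow> (real^3) set \<Rightarrow> int" where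
  "crossing_sum P \<xi> \<gamma> =
     (\<Sum>i\<in>{0..<int (length P)}. crossing_sign (vtx P i) (vtx P (i + 1)) \<xi> \<gamma>)"

text \<open>The choice operator renders ``any'' half great circle that avoids the vertices of the
  polar polygon; if the polar polygon is a spherical polygon and \<open>\<xi>\<close> is admissible, such half
  great circles exist and all give the same sum.\<close>

definition normal_degree :: "(real^3) list \<Rightarrow> real^3 \<Rightarrow> int" where
  "normal_degree W \<xi> =
     crossing_sum (polar_polygon W) \<xi>
       (SOME \<gamma>. \<gamma> \<in> half_great_circles \<xi> \<and> \<gamma> \<inter> set (polar_polygon W) = {})"

end

theory Submission
  imports Defs
begin

text \<open>
  Rewriting the crossings of the polar polygon with a half great circle in terms of \<open>W\<close>, one
  finds that \<open>2 d(W, \<xi>)\<close> is the sum, over the vertices at which the longitude about an axis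
  \<open>v\<close> orthogonal to \<open>\<xi>\<close> is extremal, of the sign of the turn made by \<open>W\<close> there times the sign of
  the height \<open>\<langle>\<xi>, w\<^sub>i\<rangle>\<close>. A discrete form of Hopf's secant argument evaluates sums of such turns:
  the turn at a vertex is the sum of two secant terms (a vertex \<open>x\<close> contributes to an edge \<open>pq\<close> if its
  longitude lies between those of \<open>p\<close> and \<open>q\<close>), and the four secant terms belonging to two disjoint
  edges balance, so that the path of summation can be moved. For a maximal run of
  vertices on one side of the great circle \<open>S(\<xi>)\<close> this bounds the sum of the turns by 1. There are \<open>2 M\<close>
  runs, hence \<open>\<bar>d\<bar> \<le> M\<close> if \<open>M > 0\<close>. For the closed polygon it gives twice the number of
  edges covering the longitude of one vertex, up to signs and a boundary term, which determines \<open>d\<close> modulo 2. Finally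
  \<open>d \<equiv> M - 1\<close> modulo 2 improves \<open>\<bar>d\<bar> \<le> M\<close> to \<open>\<bar>d\<bar> \<le> M - 1\<close>.

  Conversely, a polygon made of two zigzags along \<open>S(\<xi>)\<close>, run through in opposite directions,
  has a normal degree equal to the difference of their lengths.
\<close>

unbundle cross3_syntax

section \<open>Signs of triple products\<close>

definition triple :: "real^3 \<Rightarrow> real^3 \<Rightarrow> real^3 \<Rightarrow> real" where
  "triple a b c = (a \<times> b) \<bullet> c"

text \<open>Written with the floor so that it agrees literally with the sign in
  \<open>crossing_sign\<close>.\<close>

definition isgn :: "real \<Rightarrow> int" where
  "isgn x = \<lfloor>sgn x\<rfloor>"

lemma isgn_if: "isgn x = (if x > 0 then 1 else if x < 0 then -1 else 0)"
  using floor_of_int[of "-1", where ?'a = real] by (simp add: isgn_def sgn_if)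

lemma isgn_nonzero: "x \<noteq> 0 \<Longrightarrow> isgn x = (if x > 0 then 1 else -1)"
  by (auto simp: isgn_if)

lemma isgn_simps [simp]: "x > 0 \<Longrightarrow> isgn x = 1" "x < 0 \<Longrightarrow> isgn x = -1" "isgn 0 = 0"
  by (auto simp: isgn_if)

lemma isgn_minus [simp]: "isgn (- x) = - isgn x"
  by (auto simp: isgn_if)

lemma isgn_mult: "isgn (x * y) = isgn x * isgn y"
  by (auto simp: isgn_if zero_less_mult_iff mult_less_0_iff)

lemma triple_expand:
  "triple a b c = a$1 * (b$2 * c$3 - b$3 * c$2) - a$2 * (b$1 * c$3 - b$3 * c$1)
     + a$3 * (b$1 * c$2 - b$2 * c$1)"
  by (simp add: triple_def cross3_def inner_vec_def sum_3 algebra_simps)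

lemma triple_swap: "triple b a c = - triple a b c" "triple a c b = - triple a b c"
  by (simp_all add: triple_expand algebra_simps)

lemma triple_same [simp]: "triple a a c = 0" "triple a c a = 0" "triple c a a = 0"
  by (simp_all add: triple_expand algebra_simps)

text \<open>For a fixed axis \<open>v\<close>, \<open>triple a b v\<close> is the determinant of the projections of \<open>a\<close> and \<open>b\<close>
  along \<open>v\<close>; \<open>between v p x q\<close> says that the half plane bounded by the axis through \<open>x\<close> lies
  strictly inside the convex sector formed by those through \<open>p\<close> and \<open>q\<close>.\<close>

definition between :: "real^3 \<Rightarrow> real^3 \<Rightarrow> real^3 \<Rightarrow> real^3 \<Rightarrow> bool" where
  "between v p x q \<longleftrightarrow> triple p x v * triple x q v > 0 \<and> triple p x v * triple p q v > 0"

text \<open>A secant term: while a point runs from \<open>p\<close> to \<open>q\<close>, its secant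
  to the fixed \<open>x\<close> becomes parallel to the axis if the longitude of \<open>x\<close> is
  passed, and the sign is the sense in which the secant then rotates.\<close>

definition sector_sign :: "real^3 \<Rightarrow> real^3 \<Rightarrow> real^3 \<Rightarrow> real^3 \<Rightarrow> int" where
  "sector_sign v x p q = (if between v p x q then isgn (triple x p q) else 0)"

definition turn_sign :: "real^3 \<Rightarrow> real^3 \<Rightarrow> real^3 \<Rightarrow> real^3 \<Rightarrow> int" where
  "turn_sign v a b c = (if triple a b v * triple b c v < 0 then isgn (triple a b c) else 0)"

text \<open>Up to sign the four determinants are the coefficients of the linear relation between the
  four vectors. The pattern equates a positive combination of \<open>a\<close>, \<open>b\<close>
  with one of \<open>p\<close>, \<open>q\<close>. Four vanishing signs would satisfy it as well, so
  it is applied only to nonzero determinants.\<close>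

definition arcs_cross :: "real^3 \<Rightarrow> real^3 \<Rightarrow> real^3 \<Rightarrow> real^3 \<Rightarrow> bool" where
  "arcs_cross a b p q \<longleftrightarrow>
     isgn (triple b p q) = - isgn (triple a p q) \<and>
     isgn (triple b p q) = - isgn (triple a b q) \<and>
     isgn (triple b p q) = isgn (triple a b p)"

text \<open>If \<open>b\<close> is extremal, \<open>a\<close> and \<open>c\<close> lie on the same
  side of it in longitude, and exactly one of them lies between the other and \<open>b\<close>; if
  \<open>b\<close> is not extremal, neither does. The signs agree because the determinant is
  cyclic.\<close>

lemma turn_eq_sector:
  assumes "triple a b v \<noteq> 0" "triple b c v \<noteq> 0" "triple a c v \<noteq> 0"
  shows "turn_sign v a b c = sector_sign v a b c + sector_sign v c a b"
proof -
  have s: "triple b a v = - triple a b v" "triple c b v = - triple b c v"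
    "triple c a v = - triple a c v" "triple c a b = triple a b c"
    by (simp_all add: triple_expand algebra_simps)
  show ?thesis
    using assms unfolding turn_sign_def sector_sign_def between_def s
    by (auto simp: zero_less_mult_iff mult_less_0_iff)
qed

text \<open>The first ten hypotheses exclude the sign patterns incompatible with the Pluecker relations
  between four vectors in space and their projections along an axis, the last one excludes a
  crossing of the arcs.\<close>

lemma bool_square:
  fixes ab ap aq bp bq pq A B G D :: bool
  assumes "\<not> ((ab \<and> \<not> B \<or> \<not> ab \<and> B) \<and> (ap \<and> G \<or> \<not> ap \<and> \<not> G) \<and> (aq \<and> \<not> D \<or> \<not> aq \<and> D))"
    "\<not> ((ab \<and> B \<or> \<not> ab \<and> \<not> B) \<and> (ap \<and> \<not> G \<or> \<not> ap \<and> G) \<and> (aq \<and> D \<or> \<not> aq \<and> \<not> D))"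
    "\<not> ((ab \<and> \<not> A \<or> \<not> ab \<and> A) \<and> (bp \<and> G \<or> \<not> bp \<and> \<not> G) \<and> (bq \<and> \<not> D \<or> \<not> bq \<and> D))"
    "\<not> ((ab \<and> A \<or> \<not> ab \<and> \<not> A) \<and> (bp \<and> \<not> G \<or> \<not> bp \<and> G) \<and> (bq \<and> D \<or> \<not> bq \<and> \<not> D))"
    "\<not> ((ap \<and> \<not> A \<or> \<not> ap \<and> A) \<and> (bp \<and> B \<or> \<not> bp \<and> \<not> B) \<and> (pq \<and> \<not> D \<or> \<not> pq \<and> D))"
    "\<not> ((ap \<and> A \<or> \<not> ap \<and> \<not> A) \<and> (bp \<and> \<not> B \<or> \<not> bp \<and> B) \<and> (pq \<and> D \<or> \<not> pq \<and> \<not> D))"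
    "\<not> ((aq \<and> \<not> A \<or> \<not> aq \<and> A) \<and> (bq \<and> B \<or> \<not> bq \<and> \<not> B) \<and> (pq \<and> \<not> G \<or> \<not> pq \<and> G))"
    "\<not> ((aq \<and> A \<or> \<not> aq \<and> \<not> A) \<and> (bq \<and> \<not> B \<or> \<not> bq \<and> B) \<and> (pq \<and> G \<or> \<not> pq \<and> \<not> G))"
    "\<not> ((ab \<and> pq \<or> \<not> ab \<and> \<not> pq) \<and> (ap \<and> \<not> bq \<or> \<not> ap \<and> bq) \<and> (aq \<and> bp \<or> \<not> aq \<and> \<not> bp))"
    "\<not> ((ab \<and> \<not> pq \<or> \<not> ab \<and> pq) \<and> (ap \<and> bq \<or> \<not> ap \<and> \<not> bq) \<and> (aq \<and> \<not> bp \<or> \<not> aq \<and> bp))"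
    "\<not> ((A \<longleftrightarrow> \<not> B) \<and> (A \<longleftrightarrow> \<not> G) \<and> (A \<longleftrightarrow> D))"
  shows "(if (ap \<and> \<not> bp \<or> \<not> ap \<and> bp) \<and> (ap \<and> ab \<or> \<not> ap \<and> \<not> ab) then if D then 1 else - 1 else (0::int))
      + (if (\<not> bp \<and> bq \<or> bp \<and> \<not> bq) \<and> (\<not> bp \<and> pq \<or> bp \<and> \<not> pq) then if A then 1 else - 1 else (0::int))
    = (if (\<not> ap \<and> aq \<or> ap \<and> \<not> aq) \<and> (\<not> ap \<and> pq \<or> ap \<and> \<not> pq) then if B then 1 else - 1 else (0::int))
      + (if (aq \<and> \<not> bq \<or> \<not> aq \<and> bq) \<and> (aq \<and> ab \<or> \<not> aq \<and> \<not> ab) then if G then 1 else - 1 else (0::int))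
    \<and> \<bar>(if (ap \<and> \<not> bp \<or> \<not> ap \<and> bp) \<and> (ap \<and> ab \<or> \<not> ap \<and> \<not> ab) then if D then 1 else - 1 else (0::int))
      + (if (\<not> bp \<and> bq \<or> bp \<and> \<not> bq) \<and> (\<not> bp \<and> pq \<or> bp \<and> \<not> pq) then if A then 1 else - 1 else (0::int))\<bar> \<le> 1"
  using assms by smt

lemma nonzero_neg_iff: "x \<noteq> 0 \<Longrightarrow> x < 0 \<longleftrightarrow> \<not> x > (0::real)"
  by auto

text \<open>The four terms are the sides of one cell in the grid of secants, with one end on the arc
  \<open>ab\<close> and the other on \<open>pq\<close>. An imbalance would require a secant of
  length zero, that is, a crossing of the arcs.\<close>

lemma sector_sign_square:
  assumes nz: "triple a b v \<noteq> 0" "triple a p v \<noteq> 0" "triple a q v \<noteq> 0"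
      "triple b p v \<noteq> 0" "triple b q v \<noteq> 0" "triple p q v \<noteq> 0"
    and nz3: "triple b p q \<noteq> 0" "triple a p q \<noteq> 0" "triple a b q \<noteq> 0" "triple a b p \<noteq> 0"
    and nc: "\<not> arcs_cross a b p q"
  shows "sector_sign v p a b + sector_sign v b p q = sector_sign v a p q + sector_sign v q a b"
    and "\<bar>sector_sign v p a b + sector_sign v b p q\<bar> \<le> 1"
proof -
  \<comment> \<open>Three-term Pluecker relations: four that mix determinants with and without the
    axis, and the planar one for the projections.\<close>
  have e: "- (triple a b v * triple a p q) + triple a p v * triple a b q - triple a q v * triple a b p = 0"
    "- (triple a b v * triple b p q) + triple b p v * triple a b q - triple b q v * triple a b p = 0"
    "- (triple a p v * triple b p q) + triple b p v * triple a p q - triple p q v * triple a b p = 0"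
    "- (triple a q v * triple b p q) + triple b q v * triple a p q - triple p q v * triple a b q = 0"
    "triple a b v * triple p q v - triple a p v * triple b q v + triple a q v * triple b p v = 0"
    by (simp_all add: triple_expand algebra_simps)
  have s: "triple p b v = - triple b p v" "triple p a v = - triple a p v" "triple q b v = - triple b q v"
     "triple p a b = triple a b p" "triple q a b = triple a b q"
    by (simp_all add: triple_expand algebra_simps)
  note n = nz[THEN nonzero_neg_iff] nz3[THEN nonzero_neg_iff]
  \<comment> \<open>Three numbers with sum zero are neither all positive nor all negative, so each
    relation excludes two sign patterns.\<close>
  have c: "\<not> (triple a b v * triple a p q < 0 \<and> triple a p v * triple a b q > 0 \<and> triple a q v * triple a b p < 0)"
    "\<not> (triple a b v * triple a p q > 0 \<and> triple a p v * triple a b q < 0 \<and> triple a q v * triple a b p > 0)"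
    "\<not> (triple a b v * triple b p q < 0 \<and> triple b p v * triple a b q > 0 \<and> triple b q v * triple a b p < 0)"
    "\<not> (triple a b v * triple b p q > 0 \<and> triple b p v * triple a b q < 0 \<and> triple b q v * triple a b p > 0)"
    "\<not> (triple a p v * triple b p q < 0 \<and> triple b p v * triple a p q > 0 \<and> triple p q v * triple a b p < 0)"
    "\<not> (triple a p v * triple b p q > 0 \<and> triple b p v * triple a p q < 0 \<and> triple p q v * triple a b p > 0)"
    "\<not> (triple a q v * triple b p q < 0 \<and> triple b q v * triple a p q > 0 \<and> triple p q v * triple a b q < 0)"
    "\<not> (triple a q v * triple b p q > 0 \<and> triple b q v * triple a p q < 0 \<and> triple p q v * triple a b q > 0)"
    "\<not> (triple a b v * triple p q v > 0 \<and> triple a p v * triple b q v < 0 \<and> triple a q v * triple b p v > 0)"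
    "\<not> (triple a b v * triple p q v < 0 \<and> triple a p v * triple b q v > 0 \<and> triple a q v * triple b p v < 0)"
    using e by linarith+
  have d: "\<not> ((triple b p q > 0 \<longleftrightarrow> \<not> triple a p q > 0) \<and> (triple b p q > 0 \<longleftrightarrow> \<not> triple a b q > 0)
      \<and> (triple b p q > 0 \<longleftrightarrow> triple a b p > 0))"
    using nc unfolding arcs_cross_def isgn_if n by (auto split: if_splits)
  note c' = c[unfolded zero_less_mult_iff mult_less_0_iff n]
  have *: "sector_sign v p a b + sector_sign v b p q = sector_sign v a p q + sector_sign v q a b
    \<and> \<bar>sector_sign v p a b + sector_sign v b p q\<bar> \<le> 1"
    using bool_square[OF c' d]
    unfolding sector_sign_def between_def s nz3[THEN isgn_nonzero] zero_less_mult_iff mult_less_0_iff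
      neg_0_less_iff_less neg_less_0_iff_less n
    by blast
  show "sector_sign v p a b + sector_sign v b p q = sector_sign v a p q + sector_sign v q a b"
    and "\<bar>sector_sign v p a b + sector_sign v b p q\<bar> \<le> 1" using * by auto
qed

text \<open>Two open convex sectors are disjoint or meet in a sector with two boundary half planes,
  each bounding one of them and lying inside the other. So none or two of the four statements
  hold.\<close>

lemma between_even:
  assumes nz: "triple e f v \<noteq> 0" "triple e p v \<noteq> 0" "triple e q v \<noteq> 0"
      "triple f p v \<noteq> 0" "triple f q v \<noteq> 0" "triple p q v \<noteq> 0"
  shows "even (of_bool (between v p e q) + of_bool (between v p f q)
    + of_bool (between v e p f) + of_bool (between v e q f) :: int)"
proof -
  have e: "triple e f v * triple p q v - triple e p v * triple f q v + triple e q v * triple f p v = 0"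
    by (simp add: triple_expand algebra_simps)
  have s: "triple p e v = - triple e p v" "triple p f v = - triple f p v" "triple q f v = - triple f q v"
    by (simp_all add: triple_expand algebra_simps)
  have l: "\<not> (triple e f v * triple p q v > 0 \<and> triple e p v * triple f q v < 0 \<and> triple e q v * triple f p v > 0)"
     "\<not> (triple e f v * triple p q v < 0 \<and> triple e p v * triple f q v > 0 \<and> triple e q v * triple f p v < 0)"
    using e by auto
  note n = nz[THEN nonzero_neg_iff]
  show ?thesis
    using l unfolding between_def s
    by (simp add: zero_less_mult_iff mult_less_0_iff n) (smt (verit) )
qed

text \<open>If \<open>e\<close> and \<open>a\<close> lie on the same side of \<open>c\<close>,
  exactly one of them separates the other from \<open>c\<close>. This serves at the edges incident
  with the reference vertex, where \<open>between_even\<close> is not applicable.\<close>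

lemma between_exchange:
  assumes "triple c e v \<noteq> 0" "triple c a v \<noteq> 0" "triple e a v \<noteq> 0"
  shows "of_bool (between v e a c) + of_bool (between v c e a)
    = (of_bool (triple c e v * triple c a v > 0) :: int)"
proof -
  have s: "triple a c v = - triple c a v" "triple e c v = - triple c e v"
    by (simp_all add: triple_expand algebra_simps)
  show ?thesis
    using assms unfolding between_def s
    by (auto simp: zero_less_mult_iff mult_less_0_iff)
qed

section \<open>Sums over secants\<close>

lemma sum_int_last: "a \<le> b + 1 \<Longrightarrow> sum f {a..b + 1} = sum f {a..b} + f (b + 1 :: int)"
proof -
  assume "a \<le> b + 1"
  then have "{a..b + 1} = insert (b + 1) {a..b}" by auto
  then show ?thesis by (simp add: add.commute)
qed

lemma sum_int_first: "a \<le> b \<Longrightarrow> sum f {a..b} = f (a::int) + sum f {a + 1..b}"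
proof -
  assume "a \<le> b"
  then have "{a..b} = insert a {a + 1..b}" by auto
  then show ?thesis by simp
qed

lemma sum_int_last': "a \<le> b \<Longrightarrow> sum f {a..b} = sum f {a..b - 1} + f (b :: int)"
  using sum_int_last[of a "b - 1" f] by simp

lemma sum_int_telescope:
  fixes f :: "int \<Rightarrow> 'a::ab_group_add"
  assumes "a \<le> b + 1"
  shows "(\<Sum>i\<in>{a..b}. f (i + 1) - f i) = f (b + 1) - f a"
proof -
  have "a - 1 \<le> b" using assms by simp
  then show ?thesis
    by (induction b rule: int_ge_induct) (simp_all add: sum_int_last)
qed

lemma periodic_sum_shift:
  fixes f :: "int \<Rightarrow> 'a::ab_group_add"
  assumes "\<And>i. f (i + n) = f i" "n > 0"
  shows "sum f {a..a + n - 1} = sum f {0..n - 1}"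
proof (induction a rule: int_induct[where k = 0])
  case (step1 a)
  then show ?case
    using sum_int_last'[of "a + 1" "a + n" f] sum_int_first[of a "a + n - 1" f] assms
    by (simp add: algebra_simps)
next
  case (step2 a)
  then show ?case
    using sum_int_last'[of a "a + n - 1" f] sum_int_first[of "a - 1" "a + n - 2" f] assms(1)[of "a - 1"] assms(2)
    by (simp add: algebra_simps)
qed simp

lemma periodic_sum_Suc:
  fixes f :: "int \<Rightarrow> 'a::ab_group_add"
  assumes "\<And>i. f (i + n) = f i" "n > 0"
  shows "(\<Sum>i\<in>{0..n - 1}. f (i + 1)) = sum f {0..n - 1}"
proof -
  have "(\<Sum>i\<in>{0..n - 1}. f (i + 1) - f i) = f n - f 0"
    using sum_int_telescope[of 0 "n - 1" f] assms(2) by simp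
  also have "\<dots> = 0" using assms(1)[of 0] by simp
  finally show ?thesis by (simp add: sum_subtractf)
qed

text \<open>A secant is a pair \<open>(i, j)\<close>; \<open>H i j\<close> is the step to
  \<open>(i, j + 1)\<close> and \<open>V i j\<close> the step to \<open>(i + 1, j)\<close>. The left
  side follows the staircase from \<open>(a, a + 1)\<close> to \<open>(b, b + 1)\<close>; the right
  side raises the second index first and the first index afterwards. The cells between the two paths
  balance.\<close>

lemma secant_path:
  fixes H V :: "int \<Rightarrow> int \<Rightarrow> 'a::ab_group_add"
  assumes "a \<le> b"
    and "\<And>i. a < i \<Longrightarrow> i \<le> b \<Longrightarrow> E i = H (i - 1) i + V (i - 1) (i + 1)"
    and "\<And>i j. a \<le> i \<Longrightarrow> i + 1 < j \<Longrightarrow> j \<le> b \<Longrightarrow> V i j + H (i + 1) j = H i j + V i (j + 1)"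
  shows "(\<Sum>i\<in>{a + 1..b}. E i) = (\<Sum>j\<in>{a + 1..b}. H a j) + (\<Sum>i\<in>{a..b - 1}. V i (b + 1))"
  using assms
proof (induction b rule: int_ge_induct)
  case (step b)
  have IH: "(\<Sum>i\<in>{a + 1..b}. E i) = (\<Sum>j\<in>{a + 1..b}. H a j) + (\<Sum>i\<in>{a..b - 1}. V i (b + 1))"
    using step.IH step.prems by simp
  \<comment> \<open>Moving the final stretch from second index \<open>b + 1\<close> to
    \<open>b + 2\<close> crosses one strip of cells, whose \<open>H\<close> terms telescope.\<close>
  have "(\<Sum>i\<in>{a..b - 1}. V i (b + 2)) - (\<Sum>i\<in>{a..b - 1}. V i (b + 1))
      = (\<Sum>i\<in>{a..b - 1}. H (i + 1) (b + 1) - H i (b + 1))"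
    unfolding sum_subtractf[symmetric]
  proof (rule sum.cong)
    fix i assume i: "i \<in> {a..b - 1}"
    then have "V i (b + 1) + H (i + 1) (b + 1) = H i (b + 1) + V i (b + 1 + 1)"
      by (intro step.prems(2)) auto
    then show "V i (b + 2) - V i (b + 1) = H (i + 1) (b + 1) - H i (b + 1)"
      by (simp add: algebra_simps)
  qed simp
  also have "\<dots> = H b (b + 1) - H a (b + 1)"
    using sum_int_telescope[of a "b - 1" "\<lambda>i. H i (b + 1)"] step.hyps by simp
  finally have t: "(\<Sum>i\<in>{a..b - 1}. V i (b + 2)) = (\<Sum>i\<in>{a..b - 1}. V i (b + 1)) + H b (b + 1) - H a (b + 1)"
    by (simp add: algebra_simps)
  have "E (b + 1) = H b (b + 1) + V b (b + 2)"
    using step.prems(1)[of "b + 1"] step.hyps by (simp add: algebra_simps)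
  moreover have "(\<Sum>i\<in>{a + 1..b + 1}. E i) = (\<Sum>i\<in>{a + 1..b}. E i) + E (b + 1)"
    "(\<Sum>i\<in>{a + 1..b + 1}. H a i) = (\<Sum>i\<in>{a + 1..b}. H a i) + H a (b + 1)"
    using step.hyps by (simp_all add: sum_int_last)
  moreover have "(\<Sum>i\<in>{a..b + 1 - 1}. V i (b + 1 + 1)) = (\<Sum>i\<in>{a..b - 1}. V i (b + 2)) + V b (b + 2)"
    using sum_int_last'[of a b "\<lambda>i. V i (b + 2)"] step.hyps by (simp add: add.assoc)
  ultimately show ?case
    using IH t by simp
qed simp

text \<open>The cell \<open>(a, b)\<close> of the grid is avoided: for a closed polygon it belongs to two adjacent
  edges.\<close>

lemma secant_path_truncated:
  fixes H V :: "int \<Rightarrow> int \<Rightarrow> 'a::ab_group_add"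
  assumes "a + 2 \<le> b"
    and tri: "\<And>i. a < i \<Longrightarrow> i \<le> b \<Longrightarrow> E i = H (i - 1) i + V (i - 1) (i + 1)"
    and sq: "\<And>i j. a \<le> i \<Longrightarrow> i + 1 < j \<Longrightarrow> j \<le> b \<Longrightarrow> \<not> (i = a \<and> j = b)
      \<Longrightarrow> V i j + H (i + 1) j = H i j + V i (j + 1)"
  shows "(\<Sum>i\<in>{a + 1..b}. E i) = (\<Sum>j\<in>{a + 1..b - 1}. H a j) + V a b + H (a + 1) b
    + (\<Sum>i\<in>{a + 1..b - 1}. V i (b + 1))"
proof -
  \<comment> \<open>Two shorter staircases, neither of which needs the cell \<open>(a, b)\<close>,
    cover the range; their overlap is evaluated as well and subtracted.\<close>
  have 1: "(\<Sum>i\<in>{a + 1..b - 1}. E i) = (\<Sum>j\<in>{a + 1..b - 1}. H a j) + (\<Sum>i\<in>{a..b - 1 - 1}. V i (b - 1 + 1))"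
    by (rule secant_path) (use assms in auto)
  have 2: "(\<Sum>i\<in>{a + 1 + 1..b}. E i) = (\<Sum>j\<in>{a + 1 + 1..b}. H (a + 1) j) + (\<Sum>i\<in>{a + 1..b - 1}. V i (b + 1))"
    by (rule secant_path) (use assms in auto)
  have 3: "(\<Sum>i\<in>{a + 1 + 1..b - 1}. E i) = (\<Sum>j\<in>{a + 1 + 1..b - 1}. H (a + 1) j) + (\<Sum>i\<in>{a + 1..b - 1 - 1}. V i (b - 1 + 1))"
    by (rule secant_path) (use assms in auto)
  show ?thesis
    using 1 2 3 assms(1) sum_int_last'[of "a + 1" b E] sum_int_last'[of "a + 1 + 1" b E]
      sum_int_last'[of "a + 1 + 1" b "H (a + 1)"] sum_int_first[of a "b - 1 - 1" "\<lambda>i. V i b"]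
    by (simp add: algebra_simps)
qed

section \<open>Turns and heights along a generic closed polygon\<close>

lemma abs_isgn_le: "\<bar>isgn x\<bar> \<le> 1"
  by (auto simp: isgn_if)

lemma abs_turn_sign_le: "\<bar>turn_sign v a b c\<bar> \<le> 1"
  by (simp add: turn_sign_def abs_isgn_le)

lemma between_sym: "between v p x q \<longleftrightarrow> between v q x p"
  using triple_swap(1)[of q x v] triple_swap(1)[of p x v] triple_swap(1)[of p q v]
  by (auto simp: between_def zero_less_mult_iff mult_less_0_iff)

text \<open>As \<open>v\<close> is orthogonal to \<open>\<xi>\<close>, heights survive the
  projection along \<open>v\<close>, and there \<open>x\<close> is a positive combination of
  \<open>p\<close> and \<open>q\<close>.\<close>

lemma between_height:
  assumes "v \<bullet> \<xi> = 0" "between v p x q"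
  shows "\<xi> \<bullet> p > 0 \<Longrightarrow> \<xi> \<bullet> q > 0 \<Longrightarrow> \<xi> \<bullet> x > 0"
    and "\<xi> \<bullet> p < 0 \<Longrightarrow> \<xi> \<bullet> q < 0 \<Longrightarrow> \<xi> \<bullet> x < 0"
proof -
  have "triple p q v * (\<xi> \<bullet> x) - triple x q v * (\<xi> \<bullet> p) - triple p x v * (\<xi> \<bullet> q)
      = - (triple p x q * (v \<bullet> \<xi>))"
    by (simp add: triple_expand inner_vec_def sum_3 algebra_simps)
  then have eq: "triple p q v * (\<xi> \<bullet> x) = triple x q v * (\<xi> \<bullet> p) + triple p x v * (\<xi> \<bullet> q)"
    using assms(1) by simp
  have D: "(triple p q v > 0 \<and> triple x q v > 0 \<and> triple p x v > 0) \<or>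
     (triple p q v < 0 \<and> triple x q v < 0 \<and> triple p x v < 0)"
    using assms(2) by (auto simp: between_def zero_less_mult_iff)
  show "\<xi> \<bullet> x > 0" if "\<xi> \<bullet> p > 0" "\<xi> \<bullet> q > 0"
    using D
  proof (elim disjE conjE)
    assume d: "triple p q v > 0" "triple x q v > 0" "triple p x v > 0"
    then have "triple p q v * (\<xi> \<bullet> x) > 0" unfolding eq using that by (intro add_pos_pos mult_pos_pos)
    then show ?thesis using d by (simp add: zero_less_mult_iff)
  next
    assume d: "triple p q v < 0" "triple x q v < 0" "triple p x v < 0"
    then have "triple p q v * (\<xi> \<bullet> x) < 0" unfolding eq using that by (intro add_neg_neg mult_neg_pos)
    then show ?thesis using d by (simp add: mult_less_0_iff)
  qed
  show "\<xi> \<bullet> x < 0" if "\<xi> \<bullet> p < 0" "\<xi> \<bullet> q < 0"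
    using D
  proof (elim disjE conjE)
    assume d: "triple p q v > 0" "triple x q v > 0" "triple p x v > 0"
    then have "triple p q v * (\<xi> \<bullet> x) < 0" unfolding eq using that by (intro add_neg_neg mult_pos_neg)
    then show ?thesis using d by (simp add: mult_less_0_iff)
  next
    assume d: "triple p q v < 0" "triple x q v < 0" "triple p x v < 0"
    then have "triple p q v * (\<xi> \<bullet> x) > 0" unfolding eq using that by (intro add_pos_pos mult_neg_neg)
    then show ?thesis using d by (simp add: zero_less_mult_iff)
  qed
qed

text \<open>For \<open>v = \<xi> \<times> u\<close> this is the crossing of the polar edge from
  \<open>a \<times> b\<close> to \<open>b \<times> c\<close> with the half great circle through
  \<open>u\<close>, see \<open>ray_crossing_cross\<close>. Without the second condition the
  crossings with the opposite half circle, through \<open>- u\<close>, would be counted too.\<close>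

definition crossing_term :: "real^3 \<Rightarrow> real^3 \<Rightarrow> real^3 \<Rightarrow> real^3 \<Rightarrow> real^3 \<Rightarrow> int" where
  "crossing_term \<xi> v a b c =
     (if triple a b v * triple b c v < 0 \<and> triple b c v * (triple a b c * (\<xi> \<bullet> b)) > 0
      then isgn (triple a b c * (\<xi> \<bullet> b)) else 0)"

text \<open>The situation reached after perturbing the pole and the axis. Simplicity of the polygon
  enters only through \<open>no_crossing\<close>, for edges without a common vertex.\<close>

locale generic_polygon =
  fixes w :: "int \<Rightarrow> real^3" and n :: int and \<xi> v :: "real^3"
  assumes n3: "3 \<le> n"
    and periodic: "w (i + n) = w i"
    and generic3: "\<lbrakk>i mod n \<noteq> j mod n; j mod n \<noteq> k mod n; i mod n \<noteq> k mod n\<rbrakk>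
      \<Longrightarrow> triple (w i) (w j) (w k) \<noteq> 0"
    and generic2: "i mod n \<noteq> j mod n \<Longrightarrow> triple (w i) (w j) v \<noteq> 0"
    and height_nonzero: "\<xi> \<bullet> w i \<noteq> 0"
    and perp: "v \<bullet> \<xi> = 0"
    and no_crossing: "\<lbrakk>i mod n \<noteq> j mod n; (i + 1) mod n \<noteq> j mod n; (j + 1) mod n \<noteq> i mod n\<rbrakk>
      \<Longrightarrow> \<not> arcs_cross (w i) (w (i + 1)) (w j) (w (j + 1))"
begin

lemma mod_neq: "i < j \<Longrightarrow> j < i + n \<Longrightarrow> i mod n \<noteq> j mod n"
  using zdvd_imp_le[of n "j - i"] by (auto simp: mod_eq_dvd_iff dvd_diff_commute)

lemma distinct2: "i < j \<Longrightarrow> j < i + n \<Longrightarrow> triple (w i) (w j) v \<noteq> 0"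
  "i < j \<Longrightarrow> j < i + n \<Longrightarrow> triple (w j) (w i) v \<noteq> 0"
  using mod_neq[of i j] by (auto intro!: generic2)

lemma distinct3: "i < j \<Longrightarrow> j < k \<Longrightarrow> k < i + n \<Longrightarrow> triple (w i) (w j) (w k) \<noteq> 0"
  using mod_neq[of i j] mod_neq[of i k] mod_neq[of j k] by (intro generic3) auto

abbreviation "pos i \<equiv> \<xi> \<bullet> w i > 0"
abbreviation "turn i \<equiv> turn_sign v (w (i - 1)) (w i) (w (i + 1))"
abbreviation "sector i j \<equiv> sector_sign v (w i) (w j) (w (j + 1))"

lemma not_pos: "\<not> pos i \<longleftrightarrow> \<xi> \<bullet> w i < 0"
  using height_nonzero[of i] by auto

lemma shift1: "w (i + 1 + n) = w (i + 1)" "w (i + n + 1) = w (i + 1)" "w (i + n - 1) = w (i - 1)"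
  using periodic[of "i + 1"] periodic[of "i - 1"] by (simp_all add: algebra_simps)

lemma turn_sector: "turn i = sector (i - 1) i + sector (i + 1) (i - 1)"
  using turn_eq_sector[of "w (i - 1)" "w i" v "w (i + 1)"] distinct2[of "i - 1" i] distinct2[of i "i + 1"]
    distinct2[of "i - 1" "i + 1"] n3 by simp

lemma sector_square:
  assumes "i + 1 < j" "j + 1 < i + n"
  shows "sector j i + sector (i + 1) j = sector i j + sector (j + 1) i"
    and "\<bar>sector j i + sector (i + 1) j\<bar> \<le> 1"
proof -
  have "\<not> arcs_cross (w i) (w (i + 1)) (w j) (w (j + 1))"
    using assms mod_neq[of i j] mod_neq[of "i + 1" j] mod_neq[of i "j + 1"] by (intro no_crossing) auto
  then show "sector j i + sector (i + 1) j = sector i j + sector (j + 1) i"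
    and "\<bar>sector j i + sector (i + 1) j\<bar> \<le> 1"
    using sector_sign_square[of "w i" "w (i + 1)" v "w j" "w (j + 1)"] assms
    by (simp_all add: distinct2 distinct3)
qed

lemma turn_path:
  assumes "a + 2 \<le> b" "b + 1 \<le> a + n"
  shows "(\<Sum>i\<in>{a + 1..b}. turn i) = (\<Sum>j\<in>{a + 1..b - 1}. sector a j) + sector b a + sector (a + 1) b
    + (\<Sum>i\<in>{a + 1..b - 1}. sector (b + 1) i)"
  using secant_path_truncated[of a b turn sector "\<lambda>i j. sector j i"] assms turn_sector
    sector_square(1) by force

text \<open>For \<open>b = a + n - 1\<close> the path returns to \<open>w a\<close>. Both outer sums
  then run over the edges not incident with \<open>w a\<close>, and the truncated corner, formed by
  the two edges at \<open>w a\<close>, is the turn at \<open>a\<close> once more.\<close>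

lemma turn_closed:
  "(\<Sum>i\<in>{0..n - 1}. turn i) = 2 * turn a + 2 * (\<Sum>j\<in>{a + 1..a + n - 2}. sector a j)"
proof -
  have "(\<Sum>i\<in>{0..n - 1}. turn i) = (\<Sum>i\<in>{a..a + n - 1}. turn i)"
    using n3 by (intro periodic_sum_shift[symmetric]) (simp_all add: shift1 periodic)
  also have "\<dots> = turn a + (\<Sum>i\<in>{a + 1..a + n - 1}. turn i)"
    using n3 by (intro sum_int_first) auto
  also have "(\<Sum>i\<in>{a + 1..a + n - 1}. turn i) = (\<Sum>j\<in>{a + 1..a + n - 2}. sector a j)
     + sector (a + n - 1) a + sector (a + 1) (a + n - 1) + (\<Sum>i\<in>{a + 1..a + n - 2}. sector (a + n) i)"
    using turn_path[of a "a + n - 1"] n3 by (simp add: algebra_simps)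
  finally show ?thesis
    using turn_sector[of a] periodic[of a] by (simp add: shift1)
qed

lemma sector_zero:
  assumes "pos j \<longleftrightarrow> pos (j + 1)" "pos i \<noteq> pos j"
  shows "sector i j = 0"
  using between_height[OF perp, of "w j" "w i" "w (j + 1)"] assms not_pos
  by (auto simp: sector_sign_def)

text \<open>In \<open>turn_path\<close> the outer sums compare edges inside the run with
  \<open>w a\<close> or \<open>w (b + 1)\<close>, which lie on the other side of the great circle,
  and vanish by \<open>sector_zero\<close>. There remain two consecutive sides of one cell, at most
  1 in absolute value.\<close>

lemma block_bound:
  assumes "a < b" and c: "\<And>i. a < i \<Longrightarrow> i \<le> b \<Longrightarrow> pos i = c" and "pos a \<noteq> c" "pos (b + 1) \<noteq> c"
  shows "\<bar>\<Sum>i\<in>{a + 1..b}. turn i\<bar> \<le> 1"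
proof (cases "b = a + 1")
  case True
  then show ?thesis by (simp add: abs_turn_sign_le)
next
  case False
  have b: "b < a + n"
  proof (rule ccontr)
    assume "\<not> b < a + n"
    then have "pos (a + n) = c" using n3 by (intro c) auto
    then show False using assms(3) by (simp add: periodic)
  qed
  have "(\<Sum>i\<in>{a + 1..b}. turn i) = (\<Sum>j\<in>{a + 1..b - 1}. sector a j) + sector b a + sector (a + 1) b
    + (\<Sum>i\<in>{a + 1..b - 1}. sector (b + 1) i)"
    using turn_path[of a b] False b assms(1) by auto
  also have "(\<Sum>j\<in>{a + 1..b - 1}. sector a j) = 0"
    using c assms by (intro sum.neutral ballI sector_zero) auto
  also have "(\<Sum>i\<in>{a + 1..b - 1}. sector (b + 1) i) = 0"
    using c assms by (intro sum.neutral ballI sector_zero) auto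
  finally have eq: "(\<Sum>i\<in>{a + 1..b}. turn i) = sector b a + sector (a + 1) b" by simp
  show ?thesis
  \<comment> \<open>If only one vertex lies outside the run, the two edges share it and form no
    cell; the remaining terms are then the turn at \<open>a\<close>.\<close>
  proof (cases "b + 1 = a + n")
    case True
    then have "b = a + n - 1" by simp
    then have "w b = w (a - 1)" "w (b + 1) = w a" using shift1(3)[of a] periodic[of a] by simp_all
    then show ?thesis unfolding eq using turn_sector[of a] abs_turn_sign_le[of v "w (a - 1)" "w a" "w (a + 1)"]
      by simp
  next
    case F: False
    then show ?thesis unfolding eq using sector_square(2)[of a b] False b assms(1) by simp
  qed
qed


text \<open>Here \<open>s\<close> is the last vertex before the run that contains \<open>m\<close>,
  which may be unfinished. Each run completed up to \<open>s\<close> is charged to the sign change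
  at its first vertex.\<close>

lemma block_induct:
  assumes "pos a \<noteq> pos (a + 1)" "a + 1 \<le> m"
  shows "\<exists>s c. a \<le> s \<and> s < m \<and> pos s \<noteq> c \<and> (\<forall>i. s < i \<and> i \<le> m \<longrightarrow> pos i = c) \<and>
    \<bar>\<Sum>i\<in>{a + 1..s}. (if pos i then 1 else -1) * turn i\<bar> \<le> (\<Sum>i\<in>{a + 1..s}. of_bool (pos i \<noteq> pos (i - 1)))"
  using assms(2)
proof (induction m rule: int_ge_induct)
  case base
  define c where "c = pos (a + 1)"
  have "pos i = c" if "a < i" "i \<le> a + 1" for i
  proof -
    have "i = a + 1" using that by simp
    then show ?thesis by (simp add: c_def)
  qed
  moreover have "pos a \<noteq> c" using assms(1) by (simp add: c_def)
  ultimately show ?case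
    by (intro exI[of _ a] exI[of _ c]) auto
next
  case (step m)
  then obtain s c where s: "a \<le> s" "s < m" "pos s \<noteq> c" "\<And>i. s < i \<Longrightarrow> i \<le> m \<Longrightarrow> pos i = c"
    and le: "\<bar>\<Sum>i\<in>{a + 1..s}. (if pos i then 1 else -1) * turn i\<bar> \<le> (\<Sum>i\<in>{a + 1..s}. of_bool (pos i \<noteq> pos (i - 1)))"
    by blast
  show ?case
  proof (cases "pos (m + 1) = c")
    case True
    have "pos i = c" if "s < i" "i \<le> m + 1" for i
      using s(4)[of i] that True by (cases "i = m + 1") auto
    then show ?thesis using s(1-3) le by (intro exI[of _ s] exI[of _ c]) auto
  next
    case False
    have un: "{a + 1..m} = {a + 1..s} \<union> {s + 1..m}" using s by auto
    have sum: "sum f {a + 1..m} = sum f {a + 1..s} + sum f {s + 1..m}" for f :: "int \<Rightarrow> int"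
      unfolding un by (rule sum.union_disjoint) auto
    have "(\<Sum>i\<in>{s + 1..m}. (if pos i then 1 else -1) * turn i) = (\<Sum>i\<in>{s + 1..m}. (if c then 1 else -1) * turn i)"
      using s(4) by (intro sum.cong) auto
    also have "\<dots> = (if c then 1 else -1) * (\<Sum>i\<in>{s + 1..m}. turn i)"
      by (rule sum_distrib_left[symmetric])
    finally have "\<bar>\<Sum>i\<in>{s + 1..m}. (if pos i then 1 else -1) * turn i\<bar> = \<bar>\<Sum>i\<in>{s + 1..m}. turn i\<bar>"
      by simp
    also have "\<dots> \<le> 1"
      using s(2-4) False by (intro block_bound[where c = c]) auto
    also have "1 \<le> (\<Sum>i\<in>{s + 1..m}. of_bool (pos i \<noteq> pos (i - 1)) :: int)"
    proof -
      have "pos (s + 1) \<noteq> pos s" using s(2,3) s(4)[of "s + 1"] by auto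
      then have "(of_bool (pos (s + 1) \<noteq> pos (s + 1 - 1)) :: int) = 1" by simp
      moreover have "0 \<le> (\<Sum>i\<in>{s + 1 + 1..m}. of_bool (pos i \<noteq> pos (i - 1)) :: int)"
        by (rule sum_nonneg) simp
      ultimately show ?thesis
        using s(2) sum_int_first[of "s + 1" m "\<lambda>i. of_bool (pos i \<noteq> pos (i - 1)) :: int"] by linarith
    qed
    finally have "\<bar>\<Sum>i\<in>{a + 1..m}. (if pos i then 1 else -1) * turn i\<bar> \<le> (\<Sum>i\<in>{a + 1..m}. of_bool (pos i \<noteq> pos (i - 1)))"
      unfolding sum using le by linarith
    moreover have "pos i = (\<not> c)" if "m < i" "i \<le> m + 1" for i
      using that False by (cases "i = m + 1") auto
    moreover have "pos m = c" using s(2) s(4)[of m] by simp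
    ultimately show ?thesis using s(1,2) by (intro exI[of _ m] exI[of _ "\<not> c"]) auto
  qed
qed

section \<open>The crossing total: bound by the number of up-crossings, and parity\<close>

definition "upcrossings = (\<Sum>i\<in>{0..n - 1}. of_bool (pos i \<and> \<not> pos (i - 1)) :: int)"

definition "crossing_total = (\<Sum>i\<in>{0..n - 1}. crossing_term \<xi> v (w (i - 1)) (w i) (w (i + 1)))"

abbreviation "signed_turn i \<equiv> (if pos i then 1 else -1) * turn i"

lemma sign_changes:
  "(\<Sum>i\<in>{0..n - 1}. of_bool (pos i \<noteq> pos (i - 1))) = 2 * upcrossings"
proof -
  have "(\<Sum>i\<in>{0..n - 1}. of_bool (pos i \<noteq> pos (i - 1))) - 2 * upcrossings
      = (\<Sum>i\<in>{0..n - 1}. of_bool (pos (i - 1)) - of_bool (pos i) :: int)"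
    unfolding upcrossings_def sum_distrib_left sum_subtractf[symmetric] by (intro sum.cong) auto
  also have "\<dots> = 0"
    using periodic_sum_Suc[of "\<lambda>i. of_bool (pos (i - 1)) :: int" n] n3
    by (simp add: sum_subtractf shift1)
  finally show ?thesis by simp
qed

text \<open>At an extremal vertex the crossing term is the mean of the signed turn and of the sign
  of the outgoing \<open>?D\<close>. The latter is half the jump of \<open>isgn (?D i)\<close>, and
  these jumps cancel around the polygon.\<close>

lemma twice_crossing_total: "2 * crossing_total = (\<Sum>i\<in>{0..n - 1}. signed_turn i)"
proof -
  let ?D = "\<lambda>i. triple (w (i - 1)) (w i) v"
  have "4 * crossing_term \<xi> v (w (i - 1)) (w i) (w (i + 1)) = 2 * signed_turn i + (isgn (?D (i + 1)) - isgn (?D i))" for i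
  proof -
    have nz: "?D i \<noteq> 0" "?D (i + 1) \<noteq> 0" "triple (w (i - 1)) (w i) (w (i + 1)) \<noteq> 0"
      using n3 distinct2(1)[of "i - 1" i] distinct2(1)[of i "i + 1"] distinct3[of "i - 1" i "i + 1"] by simp_all
    show ?thesis
      using nz[THEN nonzero_neg_iff] height_nonzero[of i, THEN nonzero_neg_iff] nz[THEN isgn_nonzero]
      by (simp add: crossing_term_def turn_sign_def isgn_mult isgn_nonzero[OF height_nonzero]
          zero_less_mult_iff mult_less_0_iff)
  qed
  then have "4 * crossing_total = (\<Sum>i\<in>{0..n - 1}. 2 * signed_turn i + (isgn (?D (i + 1)) - isgn (?D i)))"
    unfolding crossing_total_def sum_distrib_left by (intro sum.cong) auto
  also have "\<dots> = 2 * (\<Sum>i\<in>{0..n - 1}. signed_turn i)"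
    using periodic_sum_Suc[of "\<lambda>i. isgn (?D i)" n] n3
    by (simp add: sum.distrib sum_subtractf sum_distrib_left shift1 periodic)
  finally show ?thesis by simp
qed

lemma crossing_total_le_upcrossings:
  assumes "pos a \<noteq> pos (a + 1)"
  shows "\<bar>crossing_total\<bar> \<le> upcrossings"
proof -
  \<comment> \<open>The sign change after \<open>a\<close> recurs after \<open>a + n\<close>, so
    stopping at \<open>a + n + 1\<close> forces \<open>s = a + n\<close> and the estimate covers
    exactly one period.\<close>
  obtain s c where s: "a \<le> s" "s < a + n + 1" "pos s \<noteq> c" "\<And>i. s < i \<Longrightarrow> i \<le> a + n + 1 \<Longrightarrow> pos i = c"
    and le: "\<bar>\<Sum>i\<in>{a + 1..s}. signed_turn i\<bar> \<le> (\<Sum>i\<in>{a + 1..s}. of_bool (pos i \<noteq> pos (i - 1)))"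
    using block_induct[OF assms, of "a + n + 1"] n3 by auto
  have "s = a + n"
  proof (rule ccontr)
    assume "s \<noteq> a + n"
    then have "pos (a + n) = c" "pos (a + 1 + n) = c"
      using s(2) s(4)[of "a + n"] s(4)[of "a + n + 1"] by (auto simp: add_ac)
    then show False using assms by (simp add: periodic)
  qed
  then have "\<bar>\<Sum>i\<in>{a + 1..a + 1 + n - 1}. signed_turn i\<bar> \<le> (\<Sum>i\<in>{a + 1..a + 1 + n - 1}. of_bool (pos i \<noteq> pos (i - 1)))"
    using le by simp
  then show ?thesis
    using periodic_sum_shift[of signed_turn n "a + 1"] n3 twice_crossing_total sign_changes
      periodic_sum_shift[of "\<lambda>i. of_bool (pos i \<noteq> pos (i - 1)) :: int" n "a + 1"]
    by (simp add: periodic shift1)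
qed

lemma crossing_total_sectors:
  "crossing_total = turn a + (\<Sum>j\<in>{a + 1..a + n - 2}. sector a j) - (\<Sum>i\<in>{0..n - 1}. of_bool (\<not> pos i) * turn i)"
proof -
  have "(\<Sum>i\<in>{0..n - 1}. signed_turn i) = (\<Sum>i\<in>{0..n - 1}. turn i - 2 * (of_bool (\<not> pos i) * turn i))"
    by (intro sum.cong) auto
  also have "\<dots> = (\<Sum>i\<in>{0..n - 1}. turn i) - 2 * (\<Sum>i\<in>{0..n - 1}. of_bool (\<not> pos i) * turn i)"
    by (simp only: sum_subtractf sum_distrib_left)
  finally show ?thesis using twice_crossing_total turn_closed[of a] by linarith
qed

lemma crossing_total_no_upcrossing:
  assumes "\<And>i. pos i = c"
  shows "\<bar>crossing_total\<bar> \<le> 1"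
proof -
  have \<xi>0: "\<xi> \<bullet> \<xi> > 0" using height_nonzero[of 0] by auto
  define u where "u = v \<times> \<xi>"
  \<comment> \<open>A coordinate of the central projection: when all heights have the same sign,
    \<open>r\<close> orders the longitudes linearly.\<close>
  define r where "r i = (u \<bullet> w i) / (\<xi> \<bullet> w i)" for i
  have tr: "triple (w i) (w j) v * (\<xi> \<bullet> \<xi>) = (\<xi> \<bullet> w i) * (\<xi> \<bullet> w j) * (r j - r i)" for i j
  proof -
    have "triple (w i) (w j) v * (\<xi> \<bullet> \<xi>) - ((\<xi> \<bullet> w i) * (u \<bullet> w j) - (\<xi> \<bullet> w j) * (u \<bullet> w i))
        = triple (w i) (w j) \<xi> * (v \<bullet> \<xi>)"
      unfolding u_def by (simp add: triple_expand cross3_def inner_vec_def sum_3 algebra_simps)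
    then show ?thesis
      using perp height_nonzero[of i] height_nonzero[of j] by (simp add: r_def right_diff_distrib)
  qed
  have rper: "r (i mod n) = r i" for i
  proof -
    have "w (i + k * n) = w i" for k
    proof (induction k rule: int_induct[where k = 0])
      case (step1 k)
      then show ?case using periodic[of "i + k * n"] by (simp add: algebra_simps)
    next
      case (step2 k)
      then show ?case using periodic[of "i + (k - 1) * n"] by (simp add: algebra_simps)
    qed simp
    from this[of "- (i div n)"] show ?thesis
      by (simp add: r_def minus_div_mult_eq_mod[symmetric] del: minus_div_mult_eq_mod)
  qed
  \<comment> \<open>No edge covers a vertex with maximal \<open>r\<close>, so
    \<open>turn_closed\<close> leaves only the turn there.\<close>
  have "finite (r ` {0..n - 1})" "r ` {0..n - 1} \<noteq> {}" using n3 by auto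
  then obtain a where a: "\<And>i. i \<in> {0..n - 1} \<Longrightarrow> r i \<le> r a"
    by (metis (no_types, lifting) Max_ge Max_in image_iff imageI)
  have max: "r i \<le> r a" for i
    using a[of "i mod n"] n3 by (simp add: rper)
  have "sector a j = 0" for j
  proof -
    have "\<not> between v (w j) (w a) (w (j + 1))"
    proof
      assume "between v (w j) (w a) (w (j + 1))"
      then have "0 < (triple (w j) (w a) v * (\<xi> \<bullet> \<xi>)) * (triple (w a) (w (j + 1)) v * (\<xi> \<bullet> \<xi>))"
        using \<xi>0 leD[OF inner_ge_zero[of \<xi>]]
        by (auto simp: between_def zero_less_mult_iff mult_less_0_iff)
      also have "\<dots> = (\<xi> \<bullet> w a) ^ 2 * ((\<xi> \<bullet> w j) * (\<xi> \<bullet> w (j + 1))) * ((r a - r j) * (r (j + 1) - r a))"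
        unfolding tr by (simp add: power2_eq_square algebra_simps)
      also have "\<dots> \<le> 0"
        using assms[of j] assms[of "j + 1"] max[of j] max[of "j + 1"] not_pos[of j] not_pos[of "j + 1"]
        by (intro mult_nonneg_nonpos) (auto simp: zero_le_mult_iff mult_le_0_iff)
      finally show False by simp
    qed
    then show ?thesis by (simp add: sector_sign_def)
  qed
  then have t: "(\<Sum>i\<in>{0..n - 1}. turn i) = 2 * turn a"
    using turn_closed[of a] by simp
  have "2 * crossing_total = (if c then 1 else -1) * (\<Sum>i\<in>{0..n - 1}. turn i)"
    unfolding twice_crossing_total assms by (simp add: sum_distrib_left sum_negf)
  then show ?thesis
    unfolding t using abs_turn_sign_le[of v "w (a - 1)" "w a" "w (a + 1)"] by (auto split: if_splits)
qed

lemma even_sum: "(\<And>i. i \<in> A \<Longrightarrow> even (f i :: int)) \<Longrightarrow> even (sum f A)"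
  by (rule dvd_sum)

text \<open>Modulo 2, the up-crossings together with the extremal vertices below the great circle are
  counted by the edges crossing the half plane through \<open>e\<close>, which lies on the plane of that
  circle. Their number is then compared with that of the edges crossing the half plane through
  \<open>w 0\<close>, the terms \<open>?g\<close> recording which vertices lie between the two half planes.\<close>

lemma crossing_total_parity: "odd (crossing_total + upcrossings)"
proof -
  define e where "e = v \<times> \<xi>"
  have v0: "v \<bullet> v > 0" using generic2[of 0 1] n3 by (auto simp: triple_def)
  \<comment> \<open>The determinant with \<open>e\<close> thus has the sign of the height.\<close>
  have te: "triple x e v = (v \<bullet> v) * (\<xi> \<bullet> x)" for x
  proof -
    have "triple x e v = (v \<bullet> v) * (\<xi> \<bullet> x) - (x \<bullet> v) * (v \<bullet> \<xi>)"
      unfolding e_def by (simp add: triple_expand cross3_def inner_vec_def sum_3 algebra_simps)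
    then show ?thesis using perp by simp
  qed
  have te': "triple e x v = - ((v \<bullet> v) * (\<xi> \<bullet> x))" for x
    using te[of x] triple_swap(1)[of x e v] by simp
  have te_nz: "triple (w i) e v \<noteq> 0" "triple e (w i) v \<noteq> 0" for i
    using v0 height_nonzero[of i] by (auto simp: te te')
  let ?inc = "\<lambda>j. triple (w j) (w (j + 1)) v > 0"
  let ?R = "\<lambda>j. of_bool (between v (w j) e (w (j + 1))) :: int"
  let ?C = "\<lambda>j. of_bool (between v (w j) (w 0) (w (j + 1))) :: int"
  let ?g = "\<lambda>j. of_bool (between v e (w j) (w 0)) :: int"
  let ?change = "\<lambda>j. of_bool (pos j \<noteq> pos (j + 1)) :: int"

  \<comment> \<open>Summation by parts modulo 2: a turn is the change of \<open>?inc\<close> at its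
    vertex, and shifting the weight from vertices to edges leaves the increasing edges that change
    sides.\<close>
  have 1: "even ((\<Sum>i\<in>{0..n - 1}. of_bool (\<not> pos i) * turn i) + (\<Sum>j\<in>{0..n - 1}. of_bool (?inc j) * ?change j))"
  proof -
    have "even (of_bool (\<not> pos i) * turn i + (of_bool (\<not> pos i) * of_bool (?inc (i - 1)) + of_bool (\<not> pos i) * of_bool (?inc i)))" for i
      using distinct2(1)[of "i - 1" i] distinct2(1)[of i "i + 1"] distinct3[of "i - 1" i "i + 1"] n3
      by (auto simp: turn_sign_def isgn_nonzero mult_less_0_iff)
    then have "even (\<Sum>i\<in>{0..n - 1}. of_bool (\<not> pos i) * turn i + (of_bool (\<not> pos i) * of_bool (?inc (i - 1)) + of_bool (\<not> pos i) * of_bool (?inc i)))"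
      by (intro even_sum)
    moreover have "(\<Sum>i\<in>{0..n - 1}. of_bool (\<not> pos i) * of_bool (?inc (i - 1)) :: int) = (\<Sum>i\<in>{0..n - 1}. of_bool (\<not> pos (i + 1)) * of_bool (?inc i))"
      using periodic_sum_Suc[of "\<lambda>i. of_bool (\<not> pos i) * of_bool (?inc (i - 1)) :: int" n] n3
      by (simp add: shift1 periodic)
    moreover have "even (\<Sum>i\<in>{0..n - 1}. (of_bool (\<not> pos (i + 1)) * of_bool (?inc i) + of_bool (\<not> pos i) * of_bool (?inc i)) + of_bool (?inc i) * ?change i)"
      by (intro even_sum) auto
    ultimately show ?thesis by (simp only: sum.distrib) presburger
  qed

  \<comment> \<open>An edge passes the half plane through \<open>e\<close> exactly if it changes
    sides and is increasing when it starts above, decreasing when it starts below. So among the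
    edges changing sides, \<open>?R\<close> is the parity of \<open>?inc\<close> plus
    up-crossing.\<close>
  have 2: "even ((\<Sum>j\<in>{0..n - 1}. of_bool (?inc j) * ?change j) + upcrossings + (\<Sum>j\<in>{0..n - 1}. ?R j))"
  proof -
    have up: "upcrossings = (\<Sum>j\<in>{0..n - 1}. of_bool (pos (j + 1) \<and> \<not> pos j))"
      unfolding upcrossings_def
      using periodic_sum_Suc[of "\<lambda>i. of_bool (pos i \<and> \<not> pos (i - 1)) :: int" n] n3
      by (simp add: shift1 periodic)
    have "even (of_bool (?inc j) * ?change j + of_bool (pos (j + 1) \<and> \<not> pos j) + ?R j)" for j
    proof -
      have "between v (w j) e (w (j + 1)) \<longleftrightarrow> (pos j \<noteq> pos (j + 1)) \<and> (pos j \<longleftrightarrow> ?inc j)"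
        unfolding between_def te te'
        using v0 leD[OF inner_ge_zero[of v]] height_nonzero[of j] height_nonzero[of "j + 1"] distinct2(1)[of j "j + 1"] n3
        by (auto simp: zero_less_mult_iff mult_less_0_iff)
      then show ?thesis by auto
    qed
    then have "even (\<Sum>j\<in>{0..n - 1}. of_bool (?inc j) * ?change j + of_bool (pos (j + 1) \<and> \<not> pos j) + ?R j)"
      by (intro even_sum)
    then show ?thesis unfolding up by (simp only: sum.distrib)
  qed

  \<comment> \<open>For edges not incident with \<open>w 0\<close>, \<open>between_even\<close>
    compares the two half planes; the \<open>?g\<close> terms telescope modulo 2 and leave the two
    neighbours of \<open>w 0\<close>.\<close>
  have 3: "even ((\<Sum>j\<in>{1..n - 2}. ?R j) + (\<Sum>j\<in>{1..n - 2}. ?C j) + ?g 1 + ?g (n - 1))"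
  proof -
    have "even (?R j + ?C j + ?g j + ?g (j + 1))" if "j \<in> {1..n - 2}" for j
    proof -
      have "triple e (w 0) v \<noteq> 0" "triple e (w j) v \<noteq> 0" "triple e (w (j + 1)) v \<noteq> 0"
        "triple (w 0) (w j) v \<noteq> 0" "triple (w 0) (w (j + 1)) v \<noteq> 0" "triple (w j) (w (j + 1)) v \<noteq> 0"
        using that n3 distinct2(1)[of 0 j] distinct2(1)[of 0 "j + 1"] distinct2(1)[of j "j + 1"]
        by (simp_all add: te_nz)
      from between_even[OF this] show ?thesis by simp
    qed
    then have "even (\<Sum>j\<in>{1..n - 2}. ?R j + ?C j + ?g j + ?g (j + 1))"
      by (intro even_sum)
    moreover have "even (\<Sum>j\<in>{1..n - 2}. ?g j + ?g (j + 1) - (?g (j + 1) - ?g j))"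
      by (intro even_sum) auto
    moreover have "(\<Sum>j\<in>{1..n - 2}. ?g (j + 1) - ?g j) = ?g (n - 1) - ?g 1"
      using sum_int_telescope[of 1 "n - 2" ?g] n3 by (simp add: algebra_simps)
    ultimately show ?thesis by (simp only: sum.distrib sum_subtractf) presburger
  qed

  have 4: "even ((\<Sum>j\<in>{1..n - 2}. sector 0 j) + (\<Sum>j\<in>{1..n - 2}. ?C j))"
    unfolding sum.distrib[symmetric]
    by (intro even_sum) (use distinct3 n3 in \<open>auto simp: sector_sign_def isgn_nonzero\<close>)

  have 5: "(\<Sum>j\<in>{0..n - 1}. ?R j) = ?R 0 + (\<Sum>j\<in>{1..n - 2}. ?R j) + ?R (n - 1)"
    using sum_int_first[of 0 "n - 1" ?R] sum_int_last'[of 1 "n - 1" ?R] n3 by simp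

  have wn: "w n = w 0" "w (n - 1) = w (-1)" using periodic[of 0] periodic[of "-1"] by simp_all
  \<comment> \<open>The two edges at \<open>w 0\<close> together with these leftover terms:
    \<open>between_exchange\<close> reduces them to the sides of \<open>e\<close> and of the two
    neighbours relative to \<open>w 0\<close>, whose comparison is odd together with the
    turn.\<close>
  have 6: "odd (turn 0 + ?R 0 + ?g 1 + ?R (n - 1) + ?g (n - 1))"
  proof -
    have nz: "triple (w 0) e v \<noteq> 0" "triple (w 0) (w 1) v \<noteq> 0" "triple e (w 1) v \<noteq> 0"
        "triple (w 0) (w (-1)) v \<noteq> 0" "triple e (w (-1)) v \<noteq> 0" "triple (w (-1)) (w 0) (w 1) \<noteq> 0"
      using n3 distinct2(1)[of 0 1] distinct2(2)[of "-1" 0] distinct3[of "-1" 0 1] by (simp_all add: te_nz)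
    have "?R 0 + ?g 1 = of_bool (triple (w 0) e v * triple (w 0) (w 1) v > 0)"
      using between_exchange[OF nz(1-3)] by simp
    moreover have "?R (n - 1) + ?g (n - 1) = of_bool (triple (w 0) e v * triple (w 0) (w (-1)) v > 0)"
      using between_exchange[OF nz(1,4,5)] wn between_sym[of v "w (-1)" e "w 0"] by simp
    moreover have "odd (turn 0 + of_bool (triple (w 0) e v * triple (w 0) (w 1) v > 0)
      + of_bool (triple (w 0) e v * triple (w 0) (w (-1)) v > 0))"
      using nz triple_swap(1)[of "w 0" "w (-1)" v]
      by (auto simp: turn_sign_def isgn_nonzero zero_less_mult_iff mult_less_0_iff)
    ultimately show ?thesis by presburger
  qed
  have "crossing_total = turn 0 + (\<Sum>j\<in>{1..n - 2}. sector 0 j) - (\<Sum>i\<in>{0..n - 1}. of_bool (\<not> pos i) * turn i)"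
    using crossing_total_sectors[of 0] by simp
  then show ?thesis using 1 2 3 4 5 6 by presburger
qed

text \<open>If the polygon changes sides, parity excludes equality in the bound by
  \<open>upcrossings\<close>. If it does not, \<open>upcrossings\<close> is 0 and the required bound
  is 1.\<close>

lemma crossing_total_bound:
  "\<bar>crossing_total\<bar> \<le> \<bar>1 - upcrossings\<bar>" "even (crossing_total - (1 - upcrossings))"
proof -
  have *: "even (a - (1 - b))" "b \<noteq> \<bar>a\<bar>" if "odd (a + b)" for a b :: int
    using that by presburger+
  show "even (crossing_total - (1 - upcrossings))"
    using crossing_total_parity by (rule *)
  show "\<bar>crossing_total\<bar> \<le> \<bar>1 - upcrossings\<bar>"
  proof (cases "\<exists>a. pos a \<noteq> pos (a + 1)")
    case True
    then have "\<bar>crossing_total\<bar> \<le> upcrossings" using crossing_total_le_upcrossings by blast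
    moreover have "upcrossings \<noteq> \<bar>crossing_total\<bar>"
      using crossing_total_parity by (rule *)
    ultimately show ?thesis by linarith
  next
    case False
    have "pos i = pos 0" for i
      by (induction i rule: int_induct[where k = 0]) (use False in \<open>metis diff_add_cancel\<close>)+
    then have c: "\<bar>crossing_total\<bar> \<le> 1" by (rule crossing_total_no_upcrossing)
    have "upcrossings = 0"
      unfolding upcrossings_def by (intro sum.neutral ballI) (use False in \<open>metis diff_add_cancel of_bool_eq(1)\<close>)
    then show ?thesis using c by simp
  qed
qed

end

section \<open>The normal degree as a sum over the vertices\<close>

lemma triple_scale [simp]:
  "triple (r *\<^sub>R a) b c = r * triple a b c" "triple a (r *\<^sub>R b) c = r * triple a b c"
  "triple a b (r *\<^sub>R c) = r * triple a b c"
  by (simp_all add: triple_expand algebra_simps)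

lemma triple_add:
  "triple (a + a') b c = triple a b c + triple a' b c" "triple a (b + b') c = triple a b c + triple a b' c"
  "triple a b (c + c') = triple a b c + triple a b c'"
  by (simp_all add: triple_expand algebra_simps)

lemma triple_cross: "triple a b (\<xi> \<times> u) = (\<xi> \<bullet> a) * (u \<bullet> b) - (u \<bullet> a) * (\<xi> \<bullet> b)"
  by (simp add: triple_expand cross3_def inner_vec_def sum_3 algebra_simps)

lemma triple_inner: "triple a b c = a \<bullet> (b \<times> c)"
  by (simp add: triple_expand cross3_def inner_vec_def sum_3 algebra_simps)

lemma triple_cross_left: "triple u (b \<times> c) \<xi> = triple b c (\<xi> \<times> u)"
  "triple (a \<times> b) u \<xi> = - triple a b (\<xi> \<times> u)"
  "triple (a \<times> b) (b \<times> c) \<xi> = triple a b c * (\<xi> \<bullet> b)"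
  by (simp_all add: triple_expand cross3_def inner_vec_def sum_3 algebra_simps)

lemma triple_cramer:
  "triple p q v *\<^sub>R u = triple u q v *\<^sub>R p + triple p u v *\<^sub>R q + triple p q u *\<^sub>R v"
  by (simp add: vec_eq_iff forall_3 triple_expand algebra_simps)

lemma mem_half_great_circle:
  "x \<in> (\<lambda>t. cos t *\<^sub>R \<xi> + sin t *\<^sub>R u) ` {0..pi} \<longleftrightarrow>
    (\<exists>l m. x = l *\<^sub>R \<xi> + m *\<^sub>R u \<and> m \<ge> 0 \<and> l\<^sup>2 + m\<^sup>2 = 1)" (is "?L = ?R")
proof
  assume ?L
  then show ?R by (force simp: sin_ge_zero)
next
  assume ?R
  then obtain l m where "x = l *\<^sub>R \<xi> + m *\<^sub>R u" "m \<ge> 0" "l\<^sup>2 + m\<^sup>2 = 1" by blast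
  then show ?L using sincos_total_pi[of m l] by force
qed

text \<open>Projected along \<open>\<xi>\<close>, the half circle becomes the ray of
  \<open>u\<close> and the arc spans a sector. The inequalities in \<open>between\<close> are strict
  because \<open>P\<close> and \<open>Q\<close> are off \<open>\<gamma>\<close>; if
  \<open>P\<close>, \<open>Q\<close>, \<open>\<xi>\<close> are coplanar, both sides vanish.\<close>

lemma crossing_sign_between:
  assumes \<xi>: "norm \<xi> = 1" "norm u = 1" "\<xi> \<bullet> u = 0"
    and \<gamma>: "\<gamma> = (\<lambda>t. cos t *\<^sub>R \<xi> + sin t *\<^sub>R u) ` {0..pi}"
    and P: "norm P = 1" "P \<notin> \<gamma>" and Q: "norm Q = 1" "Q \<notin> \<gamma>"
  shows "crossing_sign P Q \<xi> \<gamma> = (if between \<xi> P u Q then isgn (triple P Q \<xi>) else 0)"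
proof (cases "triple P Q \<xi> = 0")
  case True
  then show ?thesis by (simp add: crossing_sign_def triple_def isgn_def)
next
  case False
  have "great_arc P Q \<inter> \<gamma> \<noteq> {} \<longleftrightarrow> between \<xi> P u Q"
  proof
    assume "great_arc P Q \<inter> \<gamma> \<noteq> {}"
    then obtain x where xa: "x \<in> great_arc P Q" and x\<gamma>: "x \<in> \<gamma>" by blast
    from xa obtain s t where st: "s \<ge> 0" "t \<ge> 0" "x = s *\<^sub>R P + t *\<^sub>R Q" and nx: "norm x = 1"
      by (auto simp: great_arc_def)
    from x\<gamma> obtain l m where lm: "x = l *\<^sub>R \<xi> + m *\<^sub>R u" "m \<ge> 0"
      unfolding \<gamma> mem_half_great_circle by blast
    have "s \<noteq> 0"
    proof
      assume "s = 0"
      then have "x = Q" using st nx Q by simp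
      then show False using x\<gamma> Q by simp
    qed
    moreover have "t \<noteq> 0"
    proof
      assume "t = 0"
      then have "x = P" using st nx P by simp
      then show False using x\<gamma> P by simp
    qed
    ultimately have st0: "s > 0" "t > 0" using st by auto
    have e1: "t * triple P Q \<xi> = m * triple P u \<xi>"
      using arg_cong[OF trans[OF st(3)[symmetric] lm(1)], of "\<lambda>x. triple P x \<xi>"]
      by (simp add: triple_add)
    have e2: "s * triple P Q \<xi> = m * triple u Q \<xi>"
      using arg_cong[OF trans[OF st(3)[symmetric] lm(1)], of "\<lambda>x. triple x Q \<xi>"]
      by (simp add: triple_add)
    have "m \<noteq> 0" using e1 st0 False by auto
    then have m: "m > 0" using lm by simp
    obtain t' s' where "triple P u \<xi> = t' * triple P Q \<xi>" "triple u Q \<xi> = s' * triple P Q \<xi>"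
        "t' > 0" "s' > 0"
      using that[of "t / m" "s / m"] e1 e2 m st0 by (simp add: field_simps)
    then show "between \<xi> P u Q"
      using False unfolding between_def
      by (cases "triple P Q \<xi> > 0") (auto simp: zero_less_mult_iff mult_less_0_iff)
  next
    assume b: "between \<xi> P u Q"
    define T where "T = triple P Q \<xi>"
    \<comment> \<open>Cramer's rule for \<open>u\<close> in the basis \<open>P\<close>,
      \<open>Q\<close>, \<open>\<xi>\<close>. Since \<open>s\<close> and \<open>t\<close> are
      positive, normalizing \<open>l *\<^sub>R \<xi> + u\<close> gives a point of both arcs.\<close>
    define s t l where "s = triple u Q \<xi> / T" and "t = triple P u \<xi> / T" and "l = - (triple P Q u / T)"
    have T: "T \<noteq> 0" using False by (simp add: T_def)
    have st: "s > 0" "t > 0"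
      using b unfolding between_def s_def t_def T_def[symmetric]
      by (auto simp: zero_less_mult_iff zero_less_divide_iff)
    have "T *\<^sub>R u = T *\<^sub>R (s *\<^sub>R P + t *\<^sub>R Q - l *\<^sub>R \<xi>)"
      using triple_cramer[of P Q \<xi> u] T by (simp add: s_def t_def l_def T_def[symmetric] algebra_simps)
    then have "u = s *\<^sub>R P + t *\<^sub>R Q - l *\<^sub>R \<xi>" using T by (simp only: scaleR_cancel_left) simp
    then have y: "s *\<^sub>R P + t *\<^sub>R Q = l *\<^sub>R \<xi> + u" by simp
    define r where "r = sqrt (1 + l\<^sup>2)"
    have r: "r > 0" "r\<^sup>2 = 1 + l\<^sup>2"
      using add_pos_nonneg[of 1 "l\<^sup>2"] by (simp_all add: r_def)
    define x where "x = (l / r) *\<^sub>R \<xi> + (1 / r) *\<^sub>R u"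
    have lr: "(l / r)\<^sup>2 + (1 / r)\<^sup>2 = 1"
    proof -
      have "(l / r)\<^sup>2 + (1 / r)\<^sup>2 = (1 + l\<^sup>2) / r\<^sup>2" by (simp add: power_divide add_divide_distrib)
      also have "\<dots> = r\<^sup>2 / r\<^sup>2" by (simp only: r(2))
      finally show ?thesis using r(1) by simp
    qed
    then have "x \<in> \<gamma>" unfolding \<gamma> mem_half_great_circle x_def using r by force
    moreover have "norm x = 1"
    proof -
      have "x \<bullet> x = (l / r)\<^sup>2 * (\<xi> \<bullet> \<xi>) + (1 / r)\<^sup>2 * (u \<bullet> u)"
        using \<xi>(3) by (simp add: x_def inner_add_left inner_add_right inner_commute power2_eq_square)
      also have "\<dots> = 1" using lr \<xi>(1,2) by (simp add: norm_eq_1)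
      finally show ?thesis by (simp add: norm_eq_1)
    qed
    moreover have "x = (s / r) *\<^sub>R P + (t / r) *\<^sub>R Q"
    proof -
      have "x = (1 / r) *\<^sub>R (l *\<^sub>R \<xi> + u)" by (simp add: x_def algebra_simps)
      also have "\<dots> = (s / r) *\<^sub>R P + (t / r) *\<^sub>R Q" unfolding y[symmetric] by (simp add: algebra_simps)
      finally show ?thesis .
    qed
    ultimately have "x \<in> great_arc P Q"
      using st r unfolding great_arc_def by (intro CollectI conjI exI[of _ "s / r"] exI[of _ "t / r"]) simp_all
    then show "great_arc P Q \<inter> \<gamma> \<noteq> {}" using \<open>x \<in> \<gamma>\<close> by blast
  qed
  then show ?thesis by (simp add: crossing_sign_def triple_def isgn_def)
qed

text \<open>Turning the ray from \<open>u\<close> to \<open>f\<close> changes the crossing number of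
  \<open>PQ\<close> by a difference of end point terms, which will telescope. Three degeneracies are
  permitted: \<open>P\<close> or \<open>Q\<close> on the ray opposite to \<open>u\<close>, and
  \<open>P\<close>, \<open>Q\<close> on a common ray.\<close>

lemma sector_exchange:
  assumes f: "triple f P \<xi> \<noteq> 0" "triple f Q \<xi> \<noteq> 0" "triple u f \<xi> \<noteq> 0"
    and uP: "triple u P \<xi> = 0 \<Longrightarrow> triple u f \<xi> * triple P f \<xi> < 0"
    and uQ: "triple u Q \<xi> = 0 \<Longrightarrow> triple u f \<xi> * triple Q f \<xi> < 0"
    and PQ: "triple P Q \<xi> = 0 \<Longrightarrow> triple P f \<xi> * triple Q f \<xi> > 0"
  shows "(if between \<xi> P u Q then isgn (triple P Q \<xi>) else 0) - (if between \<xi> P f Q then isgn (triple P Q \<xi>) else 0)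
    = isgn (triple u f \<xi>) * of_bool (between \<xi> u Q f) - isgn (triple u f \<xi>) * of_bool (between \<xi> u P f)"
proof -
  have s: "triple P u \<xi> = - triple u P \<xi>" "triple P f \<xi> = - triple f P \<xi>" "triple Q f \<xi> = - triple f Q \<xi>"
    by (simp_all add: triple_expand algebra_simps)
  have e: "triple P Q \<xi> * triple u f \<xi> - triple u P \<xi> * triple f Q \<xi> + triple f P \<xi> * triple u Q \<xi> = 0"
    by (simp add: triple_expand algebra_simps)
  have PuQ: "triple u P \<xi> = 0 \<longleftrightarrow> triple u Q \<xi> = 0" if "triple P Q \<xi> = 0"
    using e that f by auto
  consider "triple P Q \<xi> = 0" "triple u P \<xi> = 0" "triple u Q \<xi> = 0"
    | "triple P Q \<xi> = 0" "triple u P \<xi> \<noteq> 0" "triple u Q \<xi> \<noteq> 0"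
    | "triple P Q \<xi> \<noteq> 0" "triple u P \<xi> = 0" "triple u Q \<xi> \<noteq> 0"
    | "triple P Q \<xi> \<noteq> 0" "triple u P \<xi> \<noteq> 0" "triple u Q \<xi> = 0"
    | "triple P Q \<xi> \<noteq> 0" "triple u P \<xi> \<noteq> 0" "triple u Q \<xi> \<noteq> 0"
    using PuQ e f by fastforce
  then show ?thesis
  proof cases
    case 1
    then show ?thesis by (simp add: between_def)
  next
    case 2
    note n = f(1,2,3)[THEN nonzero_neg_iff] 2(2,3)[THEN nonzero_neg_iff]
    have l: "triple u P \<xi> * triple f Q \<xi> > 0 \<longleftrightarrow> triple f P \<xi> * triple u Q \<xi> > 0"
      using e 2 by simp
    show ?thesis
      using PQ[OF 2(1)] l unfolding between_def s 2(1)
      by (simp add: zero_less_mult_iff mult_less_0_iff n) blast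
  next
    case 3
    note n = f(1,2,3)[THEN nonzero_neg_iff] 3(1,3)[THEN nonzero_neg_iff]
    have l: "triple P Q \<xi> * triple u f \<xi> > 0 \<longleftrightarrow> triple f P \<xi> * triple u Q \<xi> < 0"
      using e 3 by auto
    show ?thesis
      using uP[OF 3(2)] l unfolding between_def s 3(2)
      by (simp add: zero_less_mult_iff mult_less_0_iff n isgn_nonzero[OF f(3)] isgn_nonzero[OF 3(1)]) blast
  next
    case 4
    note n = f(1,2,3)[THEN nonzero_neg_iff] 4(1,2)[THEN nonzero_neg_iff]
    have l: "triple P Q \<xi> * triple u f \<xi> > 0 \<longleftrightarrow> triple u P \<xi> * triple f Q \<xi> > 0"
      using e 4 by auto
    show ?thesis
      using uQ[OF 4(3)] l unfolding between_def s 4(3)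
      by (simp add: zero_less_mult_iff mult_less_0_iff n isgn_nonzero[OF f(3)] isgn_nonzero[OF 4(1)]) blast
  next
    case 5
    note n = f(1,2,3)[THEN nonzero_neg_iff] 5[THEN nonzero_neg_iff]
    have l: "\<not> (triple P Q \<xi> * triple u f \<xi> > 0 \<and> triple u P \<xi> * triple f Q \<xi> < 0 \<and> triple f P \<xi> * triple u Q \<xi> > 0)"
      "\<not> (triple P Q \<xi> * triple u f \<xi> < 0 \<and> triple u P \<xi> * triple f Q \<xi> > 0 \<and> triple f P \<xi> * triple u Q \<xi> < 0)"
      using e by auto
    show ?thesis
      using l unfolding between_def s
      by (simp add: zero_less_mult_iff mult_less_0_iff n isgn_nonzero[OF f(3)] isgn_nonzero[OF 5(1)]) (smt (verit))
  qed
qed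

section \<open>Coplanar vectors and crossing arcs\<close>

lemma triple_zero_imp_coplanar:
  assumes "triple a b c = 0" "norm a = 1"
  shows "\<exists>\<xi>\<in>sphere 0 1. \<xi> \<bullet> a = 0 \<and> \<xi> \<bullet> b = 0 \<and> \<xi> \<bullet> c = 0"
proof -
  have N: "\<exists>\<xi>\<in>sphere 0 1. \<xi> \<bullet> a = 0 \<and> \<xi> \<bullet> b = 0 \<and> \<xi> \<bullet> c = 0"
    if "x \<noteq> 0" "x \<bullet> a = 0" "x \<bullet> b = 0" "x \<bullet> c = 0" for x
    using that by (intro bexI[of _ "x /\<^sub>R norm x"]) auto
  consider "a \<times> b \<noteq> 0" | "a \<times> c \<noteq> 0" | "a \<times> b = 0" "a \<times> c = 0" by blast
  then show ?thesis
  proof cases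
    case 1
    then show ?thesis using assms by (intro N[of "a \<times> b"]) (auto simp: triple_def dot_cross_self inner_commute)
  next
    case 2
    have "(a \<times> c) \<bullet> b = - triple a b c"
      by (simp add: triple_expand cross3_def inner_vec_def sum_3 algebra_simps)
    with 2 show ?thesis using assms by (intro N[of "a \<times> c"]) (auto simp: dot_cross_self inner_commute)
  next
    case 3
    obtain y where y: "y \<noteq> 0" "orthogonal a y"
      using orthogonal_to_vector_exists[of a] by auto
    have aa: "a \<bullet> a = 1" using assms by (simp add: norm_eq_1)
    have par: "y \<bullet> x = 0" if "a \<times> x = 0" for x
    proof -
      have "a \<times> (a \<times> x) = (a \<bullet> x) *\<^sub>R a - (a \<bullet> a) *\<^sub>R x" by (rule Lagrange)
      then have "x = (a \<bullet> x) *\<^sub>R a" using that aa by simp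
      then have "y \<bullet> x = (a \<bullet> x) * (y \<bullet> a)" by (metis inner_scaleR_right)
      then show ?thesis using y by (simp add: orthogonal_def inner_commute)
    qed
    show ?thesis
      using y par[of b] par[of c] 3 by (intro N[of y]) (auto simp: orthogonal_def inner_commute)
  qed
qed

text \<open>The sign pattern makes the linear relation an equality of two positive combinations;
  normalizing it gives the common point. The nonzero determinants with \<open>b\<close> and
  \<open>q\<close> distinguish it from the excluded end points.\<close>

lemma arcs_cross_imp_common_point:
  assumes "arcs_cross a b p q"
    and nz: "triple b p q \<noteq> 0" "triple a p q \<noteq> 0" "triple a b q \<noteq> 0" "triple a b p \<noteq> 0"
  shows "(great_arc a b - {b}) \<inter> (great_arc p q - {q}) \<noteq> {}"
proof -
  define x where "x = \<bar>triple b p q\<bar> *\<^sub>R a + \<bar>triple a p q\<bar> *\<^sub>R b"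
  have rel: "triple b p q *\<^sub>R a - triple a p q *\<^sub>R b = triple a b p *\<^sub>R q - triple a b q *\<^sub>R p"
    by (simp add: vec_eq_iff forall_3 triple_expand algebra_simps)
  have x': "x = \<bar>triple a b q\<bar> *\<^sub>R p + \<bar>triple a b p\<bar> *\<^sub>R q"
  proof (cases "triple b p q > 0")
    case True
    then have "triple a p q < 0" "triple a b q < 0" "triple a b p > 0"
      using assms by (auto simp: arcs_cross_def isgn_if split: if_splits)
    then show ?thesis using rel True by (simp add: x_def algebra_simps)
  next
    case False
    then have "triple b p q < 0" "triple a p q > 0" "triple a b q > 0" "triple a b p < 0"
      using assms by (auto simp: arcs_cross_def isgn_if split: if_splits)
    then show ?thesis using rel by (simp add: x_def algebra_simps)
  qed
  have 1: "triple x b q \<noteq> 0" unfolding x_def using nz by (simp add: triple_add)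
  have 2: "triple a x q \<noteq> 0"
    using nz triple_swap(2)[of a p q] unfolding x' by (simp add: triple_add)
  have 3: "triple b x q \<noteq> 0"
    using nz unfolding x' by (simp add: triple_add)
  have x0: "norm x > 0" using 1 by (auto simp: triple_def)
  define y where "y = x /\<^sub>R norm x"
  have ny: "norm y = 1" using x0 by (simp add: y_def)
  have "y = (\<bar>triple b p q\<bar> / norm x) *\<^sub>R a + (\<bar>triple a p q\<bar> / norm x) *\<^sub>R b"
    by (simp add: y_def x_def algebra_simps divide_inverse)
  then have "y \<in> great_arc a b"
    unfolding great_arc_def using ny
    by (intro CollectI conjI exI[of _ "\<bar>triple b p q\<bar> / norm x"] exI[of _ "\<bar>triple a p q\<bar> / norm x"]) simp_all
  moreover have "y = (\<bar>triple a b q\<bar> / norm x) *\<^sub>R p + (\<bar>triple a b p\<bar> / norm x) *\<^sub>R q"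
    by (simp add: y_def x' algebra_simps divide_inverse)
  then have "y \<in> great_arc p q"
    unfolding great_arc_def using ny
    by (intro CollectI conjI exI[of _ "\<bar>triple a b q\<bar> / norm x"] exI[of _ "\<bar>triple a b p\<bar> / norm x"]) simp_all
  moreover have "y \<noteq> b" using 1 x0 by (auto simp: y_def)
  moreover have "y \<noteq> q" using 3 x0 by (auto simp: y_def)
  ultimately show ?thesis by blast
qed

section \<open>Cyclic indexing of vertices and polar vertices\<close>

lemma vtx_cong: "i mod int (length W) = j mod int (length W) \<Longrightarrow> vtx W i = vtx W j"
  by (simp add: vtx_def)

lemma vtx_periodic: "vtx W (i + int (length W)) = vtx W i"
  by (simp add: vtx_def)

lemma vtx_in_set: "W \<noteq> [] \<Longrightarrow> vtx W i \<in> set W"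
  by (simp add: vtx_def nat_less_iff)

lemma length_polar [simp]: "length (polar_polygon W) = length W"
  by (simp add: polar_polygon_def)

lemma vtx_map_upto:
  assumes "n > 0"
  shows "vtx (map f [0..n - 1]) i = f (i mod n)"
proof -
  have k: "0 \<le> i mod n" "i mod n < n" using assms by simp_all
  then have "[0..n - 1] ! nat (i mod n) = i mod n" by (subst nth_upto) auto
  then show ?thesis using k assms by (simp add: vtx_def nat_less_iff)
qed

lemma vtx_polar:
  assumes "W \<noteq> []"
  shows "vtx (polar_polygon W) i = (vtx W i \<times> vtx W (i + 1)) /\<^sub>R norm (vtx W i \<times> vtx W (i + 1))"
proof -
  let ?n = "int (length W)"
  have "vtx W (i mod ?n) = vtx W i" "vtx W (i mod ?n + 1) = vtx W (i + 1)"
    by (auto intro!: vtx_cong simp: mod_add_left_eq)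
  moreover have "?n > 0" using assms by simp
  ultimately show ?thesis by (simp only: polar_polygon_def vtx_map_upto)
qed

section \<open>Generic directions, and crossings with rays about \<open>\<xi>\<close>\<close>

lemma open_avoid_hyperplanes:
  fixes U :: "'a::euclidean_space set"
  assumes "open U" "U \<noteq> {}" "finite F" "0 \<notin> F"
  shows "\<exists>x\<in>U. \<forall>f\<in>F. x \<bullet> f \<noteq> 0"
proof (rule ccontr)
  assume "\<not> ?thesis"
  then have "U \<subseteq> (\<Union>f\<in>F. {x. f \<bullet> x = 0})" by (auto simp: inner_commute)
  moreover have "negligible (\<Union>f\<in>F. {x. f \<bullet> x = 0})"
    using assms by (intro negligible_Union finite_imageI) (auto intro!: negligible_hyperplane)
  ultimately show False
    using open_not_negligible[OF assms(1,2)] negligible_subset by blast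
qed

text \<open>Removing the component along \<open>\<xi>\<close> does not change a determinant with
  \<open>\<xi>\<close>, so it suffices that \<open>y\<close> avoids finitely many planes.\<close>

lemma perp_unit_avoiding:
  assumes \<xi>: "norm \<xi> = 1" and F: "finite F" "F \<noteq> {}" "\<And>x. x \<in> F \<Longrightarrow> x \<times> \<xi> \<noteq> 0"
  obtains f where "norm f = 1" "\<xi> \<bullet> f = 0" "\<And>x. x \<in> F \<Longrightarrow> triple f x \<xi> \<noteq> 0"
proof -
  obtain y where y: "\<And>x. x \<in> F \<Longrightarrow> y \<bullet> (x \<times> \<xi>) \<noteq> 0"
    using open_avoid_hyperplanes[of UNIV "(\<lambda>x. x \<times> \<xi>) ` F"] F by fastforce
  define f where "f = y - (y \<bullet> \<xi>) *\<^sub>R \<xi>"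
  have t: "triple f x \<xi> = y \<bullet> (x \<times> \<xi>)" for x
    using triple_add(1)[of "y - (y \<bullet> \<xi>) *\<^sub>R \<xi>" "(y \<bullet> \<xi>) *\<^sub>R \<xi>" x \<xi>]
    by (simp add: f_def triple_inner[symmetric])
  have "f \<noteq> 0" using t y F(2) by (fastforce simp: triple_def)
  moreover have "\<xi> \<bullet> f = 0"
    using \<xi> by (simp add: f_def inner_diff_right inner_commute norm_eq_1)
  ultimately show thesis
    using t y by (intro that[of "f /\<^sub>R norm f"]) auto
qed

lemma between_scale:
  "r > 0 \<Longrightarrow> s > 0 \<Longrightarrow> between v (r *\<^sub>R p) x (s *\<^sub>R q) \<longleftrightarrow> between v p x q"
  by (auto simp: between_def zero_less_mult_iff mult_less_0_iff)

lemma isgn_scale: "r > 0 \<Longrightarrow> isgn (r * x) = isgn x"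
  by (simp add: isgn_mult)

definition ray_crossing :: "real^3 \<Rightarrow> real^3 \<Rightarrow> real^3 \<Rightarrow> real^3 \<Rightarrow> int" where
  "ray_crossing \<xi> u P Q = (if between \<xi> P u Q then isgn (triple P Q \<xi>) else 0)"

lemma ray_crossing_scale:
  "r > 0 \<Longrightarrow> s > 0 \<Longrightarrow> ray_crossing \<xi> u (r *\<^sub>R p) (s *\<^sub>R q) = ray_crossing \<xi> u p q"
  by (simp add: ray_crossing_def between_scale isgn_scale)

text \<open>Duality: the side of the polar vertex \<open>a \<times> b\<close> relative to the ray of
  \<open>u\<close> about \<open>\<xi>\<close> is the direction of the edge \<open>ab\<close> in
  longitude about \<open>\<xi> \<times> u\<close>. Two consecutive polar vertices and
  \<open>\<xi>\<close> have determinant \<open>triple a b c * (\<xi> \<bullet> b)\<close>.\<close>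

lemma ray_crossing_cross:
  "ray_crossing \<xi> u (a \<times> b) (b \<times> c) = crossing_term \<xi> (\<xi> \<times> u) a b c"
  unfolding ray_crossing_def crossing_term_def between_def triple_cross_left(3)
  by (auto simp: triple_cross_left(1,2) zero_less_mult_iff mult_less_0_iff)

lemma orthonormal_decomposition:
  assumes "norm \<xi> = 1" "norm u = 1" "\<xi> \<bullet> u = 0" "triple u P \<xi> = 0"
  shows "P = (\<xi> \<bullet> P) *\<^sub>R \<xi> + (u \<bullet> P) *\<^sub>R u"
proof -
  define Q where "Q = P - (\<xi> \<bullet> P) *\<^sub>R \<xi> - (u \<bullet> P) *\<^sub>R u"
  have Q: "\<xi> \<bullet> Q = 0" "u \<bullet> Q = 0"
    using assms by (simp_all add: Q_def inner_diff_right inner_commute norm_eq_1)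
  have v: "norm (\<xi> \<times> u) = 1"
    using norm_cross[of \<xi> u] assms by (intro power2_eq_imp_eq[of _ 1]) simp_all
  have "(\<xi> \<times> u) \<bullet> P = triple u P \<xi>"
    by (simp add: triple_expand cross3_def inner_vec_def sum_3 algebra_simps)
  then have "(\<xi> \<times> u) \<bullet> Q = 0"
    using assms by (simp add: Q_def inner_diff_right dot_cross_self inner_commute)
  moreover have "(\<xi> \<times> u) \<times> Q = 0"
  proof -
    have "(\<xi> \<times> u) \<times> Q = (\<xi> \<bullet> Q) *\<^sub>R u - (u \<bullet> Q) *\<^sub>R \<xi>"
      by (simp add: vec_eq_iff forall_3 cross3_def inner_vec_def sum_3 algebra_simps)
    then show ?thesis using Q by simp
  qed
  ultimately have "norm Q = 0"
    using norm_cross[of "\<xi> \<times> u" Q] v by simp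
  then show ?thesis by (simp add: Q_def algebra_simps)
qed

lemma ray_crossing_sum_invariant:
  fixes P :: "int \<Rightarrow> real^3"
  assumes "n > 0" "\<And>i. P (i + n) = P i" "triple u f \<xi> \<noteq> 0" "\<And>i. triple f (P i) \<xi> \<noteq> 0"
    and "\<And>i. triple u (P i) \<xi> = 0 \<Longrightarrow> triple u f \<xi> * triple (P i) f \<xi> < 0"
    and "\<And>i. triple (P i) (P (i + 1)) \<xi> = 0 \<Longrightarrow> triple (P i) f \<xi> * triple (P (i + 1)) f \<xi> > 0"
  shows "(\<Sum>i\<in>{0..n - 1}. ray_crossing \<xi> u (P i) (P (i + 1))) = (\<Sum>i\<in>{0..n - 1}. ray_crossing \<xi> f (P i) (P (i + 1)))"
proof -
  let ?g = "\<lambda>i. isgn (triple u f \<xi>) * of_bool (between \<xi> u (P i) f)"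
  have "ray_crossing \<xi> u (P i) (P (i + 1)) - ray_crossing \<xi> f (P i) (P (i + 1)) = ?g (i + 1) - ?g i" for i
    unfolding ray_crossing_def by (rule sector_exchange) (use assms in auto)
  then have "(\<Sum>i\<in>{0..n - 1}. ray_crossing \<xi> u (P i) (P (i + 1)) - ray_crossing \<xi> f (P i) (P (i + 1)))
      = (\<Sum>i\<in>{0..n - 1}. ?g (i + 1) - ?g i)" by simp
  also have "\<dots> = 0"
    using periodic_sum_Suc[of ?g n] assms(1,2) by (simp add: sum_subtractf)
  finally show ?thesis by (simp add: sum_subtractf)
qed

text \<open>The half circle chosen by \<open>SOME\<close> is only known to avoid the polar vertices
  and may be coplanar with \<open>\<xi>\<close> and \<open>f\<close>. The comparison therefore
  passes through a third direction \<open>f'\<close>, generic with respect to both.\<close>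

lemma normal_degree_eq:
  assumes W: "W \<noteq> []" and bend: "\<And>i. triple (vtx W i) (vtx W (i + 1)) (vtx W (i + 2)) \<noteq> 0"
    and \<xi>: "norm \<xi> = 1" and adm: "admissible W \<xi>"
    and f: "norm f = 1" "\<xi> \<bullet> f = 0" "\<And>i. triple (vtx W i) (vtx W (i + 1)) (\<xi> \<times> f) \<noteq> 0"
  shows "normal_degree W \<xi> = (\<Sum>i\<in>{0..int (length W) - 1}.
    crossing_term \<xi> (\<xi> \<times> f) (vtx W (i - 1)) (vtx W i) (vtx W (i + 1)))"
proof -
  let ?n = "int (length W)" and ?w = "vtx W"
  let ?arc = "\<lambda>u. (\<lambda>t. cos t *\<^sub>R \<xi> + sin t *\<^sub>R u) ` {0..pi}"
  define P where "P = vtx (polar_polygon W)"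
  define r where "r i = inverse (norm (?w i \<times> ?w (i + 1)))" for i
  have n: "?n > 0" using W by simp
  have edge: "?w i \<times> ?w (i + 1) \<noteq> 0" for i
    using bend[of i] by (auto simp: triple_def)
  have P: "P i = r i *\<^sub>R (?w i \<times> ?w (i + 1))" and r: "r i > 0" for i
    using W edge by (simp_all add: P_def vtx_polar r_def)
  have suc2: "i + 1 + 1 = i + 2" for i :: int by simp
  have P1: "P (i + 1) = r (i + 1) *\<^sub>R (?w (i + 1) \<times> ?w (i + 2))" for i
    using P[of "i + 1"] unfolding suc2 .
  have nP: "norm (P i) = 1" for i using edge[of i] by (simp add: P r_def)
  have Pper: "P (i + ?n) = P i" for i
    using vtx_periodic[of "polar_polygon W" i] by (simp add: P_def)
  have setP: "P i \<in> set (polar_polygon W)" for i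
    using vtx_in_set[of "polar_polygon W" i] W by (metis P_def length_0_conv length_polar)
  have setP': "\<exists>i\<in>{0..?n - 1}. x = P i" if x: "x \<in> set (polar_polygon W)" for x
  proof -
    obtain k where k: "k < length (polar_polygon W)" "polar_polygon W ! k = x"
      using x unfolding in_set_conv_nth by blast
    then have "P (int k) = x" "int k \<in> {0..?n - 1}" by (simp_all add: P_def vtx_def)
    then show ?thesis by blast
  qed
  have tP: "triple f' (P i) \<xi> = r i * triple (?w i) (?w (i + 1)) (\<xi> \<times> f')" for i f'
    by (simp add: P triple_cross_left)
  have tP': "triple (P i) f' \<xi> = - (r i * triple (?w i) (?w (i + 1)) (\<xi> \<times> f'))" for i f'
    by (simp add: P triple_cross_left)
  have inv: "(\<Sum>i\<in>{0..?n - 1}. ray_crossing \<xi> u (P i) (P (i + 1))) = (\<Sum>i\<in>{0..?n - 1}. ray_crossing \<xi> f' (P i) (P (i + 1)))"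
    if u: "norm u = 1" "\<xi> \<bullet> u = 0" "?arc u \<inter> set (polar_polygon W) = {}"
      and f': "triple u f' \<xi> \<noteq> 0" "\<And>i. triple f' (P i) \<xi> \<noteq> 0" for u f'
  proof (rule ray_crossing_sum_invariant[where P = P, OF n Pper f'])
    \<comment> \<open>A polar vertex in the plane of \<open>\<xi>\<close> and \<open>u\<close> but
      off the half circle lies strictly on the side of \<open>- u\<close>.\<close>
    fix i assume 0: "triple u (P i) \<xi> = 0"
    have dec: "P i = (\<xi> \<bullet> P i) *\<^sub>R \<xi> + (u \<bullet> P i) *\<^sub>R u"
      using orthonormal_decomposition[OF \<xi> u(1,2) 0] .
    have "P i \<bullet> P i = (\<xi> \<bullet> P i)\<^sup>2 + (u \<bullet> P i)\<^sup>2"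
      by (subst (2) dec) (simp add: inner_add_right inner_commute power2_eq_square)
    then have "(\<xi> \<bullet> P i)\<^sup>2 + (u \<bullet> P i)\<^sup>2 = 1" using nP[of i] by (simp add: norm_eq_1)
    moreover have "P i \<notin> ?arc u" using u(3) setP by blast
    ultimately have neg: "u \<bullet> P i < 0"
      using dec unfolding mem_half_great_circle by (meson not_le)
    have "triple (P i) f' \<xi> = (u \<bullet> P i) * triple u f' \<xi>"
      by (subst dec) (simp add: triple_add)
    then show "triple u f' \<xi> * triple (P i) f' \<xi> < 0"
      using neg f'(1) by (auto simp: mult_less_0_iff zero_less_mult_iff neq_iff)
  next
    \<comment> \<open>This happens only if the vertex common to the two edges has height 0;
      admissibility then puts both polar vertices on the same side.\<close>
    fix i assume "triple (P i) (P (i + 1)) \<xi> = 0"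
    then have "triple (?w i) (?w (i + 1)) (?w (i + 2)) * (\<xi> \<bullet> ?w (i + 1)) = 0"
      using r[of i] r[of "i + 1"] triple_cross_left(3)[of "?w i" "?w (i + 1)" "?w (i + 2)" \<xi>] unfolding P1 by (simp add: P)
    then have z: "\<xi> \<bullet> ?w (i + 1) = 0" using bend by simp
    then have adm': "(\<xi> \<bullet> ?w i) * (\<xi> \<bullet> ?w (i + 2)) < 0"
      using adm[unfolded admissible_def, rule_format, of "i + 1"] unfolding suc2 by simp
    have D: "triple (?w i) (?w (i + 1)) (\<xi> \<times> f') = (\<xi> \<bullet> ?w i) * (f' \<bullet> ?w (i + 1))"
      "triple (?w (i + 1)) (?w (i + 2)) (\<xi> \<times> f') = - ((\<xi> \<bullet> ?w (i + 2)) * (f' \<bullet> ?w (i + 1)))"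
      using z by (simp_all add: triple_cross)
    have "f' \<bullet> ?w (i + 1) \<noteq> 0" using f'(2)[of i] by (auto simp: tP D)
    moreover have "triple (P (i + 1)) f' \<xi> = - (r (i + 1) * triple (?w (i + 1)) (?w (i + 2)) (\<xi> \<times> f'))"
      using tP'[of "i + 1" f'] unfolding suc2 .
    ultimately show "triple (P i) f' \<xi> * triple (P (i + 1)) f' \<xi> > 0"
      using adm' r[of i] r[of "i + 1"] unfolding tP'[of i] D
      by (auto simp: zero_less_mult_iff mult_less_0_iff neq_iff)
  qed
  have fP: "triple f (P i) \<xi> \<noteq> 0" for i using f(3) r[of i] by (simp add: tP)
  have arcf: "?arc f \<inter> set (polar_polygon W) = {}"
  proof -
    have notin: "P i \<notin> ?arc f" for i
      using fP[of i] by (auto simp: mem_half_great_circle triple_add)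
    show ?thesis
    proof (rule equals0I)
      fix x assume x: "x \<in> ?arc f \<inter> set (polar_polygon W)"
      then obtain i where "x = P i" using setP'[of x] by blast
      then show False using notin[of i] x by simp
    qed
  qed
  define \<gamma> where "\<gamma> = (SOME \<gamma>. \<gamma> \<in> half_great_circles \<xi> \<and> \<gamma> \<inter> set (polar_polygon W) = {})"
  have "?arc f \<in> half_great_circles \<xi> \<and> ?arc f \<inter> set (polar_polygon W) = {}"
    using arcf f by (auto simp: half_great_circles_def)
  then have "\<gamma> \<in> half_great_circles \<xi> \<and> \<gamma> \<inter> set (polar_polygon W) = {}"
    unfolding \<gamma>_def by (rule someI)
  then obtain u where u: "norm u = 1" "\<xi> \<bullet> u = 0" "\<gamma> = ?arc u" "?arc u \<inter> set (polar_polygon W) = {}"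
    by (auto simp: half_great_circles_def)
  have cr0: "x \<times> \<xi> \<noteq> 0" if "norm x = 1" "\<xi> \<bullet> x = 0" for x
    using norm_cross[of x \<xi>] that \<xi> by (auto simp: inner_commute)
  have P\<xi>: "P i \<times> \<xi> \<noteq> 0" for i using fP[of i] by (auto simp: triple_inner)
  have "x \<times> \<xi> \<noteq> 0" if "x \<in> P ` {0..?n - 1} \<union> {u, f}" for x
    using that cr0[of u] cr0[of f] u(1,2) f(1,2) P\<xi> by auto
  then obtain f' where f': "norm f' = 1" "\<xi> \<bullet> f' = 0" "\<And>x. x \<in> P ` {0..?n - 1} \<union> {u, f} \<Longrightarrow> triple f' x \<xi> \<noteq> 0"
    using perp_unit_avoiding[of \<xi> "P ` {0..?n - 1} \<union> {u, f}"] \<xi> by blast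
  have f'P: "triple f' (P i) \<xi> \<noteq> 0" for i
    using setP'[OF setP, of i] f'(3) by auto
  have uf': "triple u f' \<xi> \<noteq> 0" "triple f f' \<xi> \<noteq> 0"
    using f'(3)[of u] f'(3)[of f] triple_swap(1)[of f' u \<xi>] triple_swap(1)[of f' f \<xi>] by auto
  have "normal_degree W \<xi> = (\<Sum>i\<in>{0..?n - 1}. crossing_sign (P i) (P (i + 1)) \<xi> \<gamma>)"
    unfolding normal_degree_def \<gamma>_def[symmetric] crossing_sum_def P_def length_polar
    by (intro sum.cong) auto
  also have "\<dots> = (\<Sum>i\<in>{0..?n - 1}. ray_crossing \<xi> u (P i) (P (i + 1)))"
    unfolding ray_crossing_def using u setP nP
    by (intro sum.cong refl crossing_sign_between \<xi>) auto
  also have "\<dots> = (\<Sum>i\<in>{0..?n - 1}. ray_crossing \<xi> f' (P i) (P (i + 1)))"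
    by (rule inv) (use u uf' f'P in auto)
  also have "\<dots> = (\<Sum>i\<in>{0..?n - 1}. ray_crossing \<xi> f (P i) (P (i + 1)))"
    by (rule inv[symmetric]) (use f arcf uf' f'P in auto)
  also have "\<dots> = (\<Sum>i\<in>{0..?n - 1}. crossing_term \<xi> (\<xi> \<times> f) (?w i) (?w (i + 1)) (?w (i + 2)))"
    unfolding P suc2 by (intro sum.cong refl) (simp only: r ray_crossing_scale ray_crossing_cross)
  also have "\<dots> = (\<Sum>i\<in>{0..?n - 1}. crossing_term \<xi> (\<xi> \<times> f) (?w (i - 1)) (?w i) (?w (i + 1)))"
    using periodic_sum_Suc[of "\<lambda>i. crossing_term \<xi> (\<xi> \<times> f) (?w (i - 1)) (?w i) (?w (i + 1))" ?n] n
      vtx_periodic[of W] vtx_periodic[of W "_ + 1"] vtx_periodic[of W "_ - 1"]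
    by (simp add: algebra_simps)
  finally show ?thesis .
qed

section \<open>Perturbation into generic position\<close>

lemma general_position_triple:
  assumes "general_position W" "set W \<subseteq> sphere 0 1" "W \<noteq> []"
    and "i mod int (length W) \<noteq> j mod int (length W)" "j mod int (length W) \<noteq> k mod int (length W)"
      "i mod int (length W) \<noteq> k mod int (length W)"
  shows "triple (vtx W i) (vtx W j) (vtx W k) \<noteq> 0"
proof
  let ?n = "int (length W)"
  assume "triple (vtx W i) (vtx W j) (vtx W k) = 0"
  moreover have "norm (vtx W i) = 1" using vtx_in_set[of W i] assms(2,3) by auto
  ultimately obtain \<xi> where \<xi>: "\<xi> \<in> sphere 0 1" "\<xi> \<bullet> vtx W i = 0" "\<xi> \<bullet> vtx W j = 0" "\<xi> \<bullet> vtx W k = 0"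
    using triple_zero_imp_coplanar by blast
  define a b c where "a = nat (i mod ?n)" and "b = nat (j mod ?n)" and "c = nat (k mod ?n)"
  have less: "a < length W" "b < length W" "c < length W"
    using assms(3) by (simp_all add: a_def b_def c_def nat_less_iff)
  have ne: "a \<noteq> b" "b \<noteq> c" "a \<noteq> c"
    using assms(3-) by (simp_all add: a_def b_def c_def eq_nat_nat_iff)
  have circle: "{W ! a, W ! b, W ! c} \<subseteq> great_circle \<xi>"
    using \<xi> vtx_in_set[of W] assms(2,3) less
    by (auto simp: great_circle_def a_def b_def c_def vtx_def subset_iff)
  have gp: False if "p < q" "q < r" "r < length W" "{W ! p, W ! q, W ! r} \<subseteq> great_circle \<xi>" for p q r
    using assms(1) \<xi>(1) that unfolding general_position_def by blast
  consider "a < b \<and> b < c" | "a < c \<and> c < b" | "b < a \<and> a < c" | "b < c \<and> c < a" | "c < a \<and> a < b" | "c < b \<and> b < a"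
    using ne by linarith
  then show False
    using gp[of a b c] gp[of a c b] gp[of b a c] gp[of b c a] gp[of c a b] gp[of c b a] less circle
    by cases auto
qed

lemma simple_polygon_no_crossing:
  assumes "simple_polygon W" "W \<noteq> []" "i mod int (length W) \<noteq> j mod int (length W)"
    and nz: "triple (vtx W (i + 1)) (vtx W j) (vtx W (j + 1)) \<noteq> 0" "triple (vtx W i) (vtx W j) (vtx W (j + 1)) \<noteq> 0"
      "triple (vtx W i) (vtx W (i + 1)) (vtx W (j + 1)) \<noteq> 0" "triple (vtx W i) (vtx W (i + 1)) (vtx W j) \<noteq> 0"
  shows "\<not> arcs_cross (vtx W i) (vtx W (i + 1)) (vtx W j) (vtx W (j + 1))"
proof
  let ?n = "int (length W)"
  assume "arcs_cross (vtx W i) (vtx W (i + 1)) (vtx W j) (vtx W (j + 1))"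
  then have "(great_arc (vtx W i) (vtx W (i + 1)) - {vtx W (i + 1)}) \<inter> (great_arc (vtx W j) (vtx W (j + 1)) - {vtx W (j + 1)}) \<noteq> {}"
    using nz by (rule arcs_cross_imp_common_point)
  moreover have "vtx W (k mod ?n) = vtx W k" "vtx W (k mod ?n + 1) = vtx W (k + 1)" for k
    by (auto intro!: vtx_cong simp: mod_add_left_eq)
  moreover have "i mod ?n \<in> {0..<?n}" "j mod ?n \<in> {0..<?n}" using assms(2) by auto
  ultimately show False
    using assms(1,3) unfolding simple_polygon_def by metis
qed

text \<open>By the last assumption a zero has neighbours of opposite signs, so a perturbation only
  decides at which of two adjacent indices the crossing is counted.\<close>

lemma upcrossings_perturb:
  fixes z z' :: "int \<Rightarrow> real"
  assumes "n > 0" "\<And>i. z (i + n) = z i" "\<And>i. z' (i + n) = z' i"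
    and "\<And>i. z i \<noteq> 0 \<Longrightarrow> z' i * z i > 0" and "\<And>i. z i = 0 \<Longrightarrow> z (i - 1) * z (i + 1) < 0"
  shows "(\<Sum>i\<in>{0..n - 1}. of_bool (z' i > 0 \<and> \<not> z' (i - 1) > 0) :: int)
    = (\<Sum>i\<in>{0..n - 1}. of_bool (z i > 0 \<and> \<not> z (i - 1) > 0))"
proof -
  \<comment> \<open>Marks an up-crossing through a zero that moves one index earlier; the
    corrections telescope.\<close>
  let ?f = "\<lambda>i. of_bool (z i = 0 \<and> z' i > 0 \<and> z (i - 1) < 0) :: int"
  have "of_bool (z' i > 0 \<and> \<not> z' (i - 1) > 0) - of_bool (z i > 0 \<and> \<not> z (i - 1) > 0) = ?f i - ?f (i - 1)" for i
    using assms(4)[of i] assms(4)[of "i - 1"] assms(5)[of i] assms(5)[of "i - 1"]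
    by (cases "z i" "0::real" rule: linorder_cases; cases "z (i - 1)" "0::real" rule: linorder_cases)
      (auto simp: zero_less_mult_iff mult_less_0_iff)
  then have "(\<Sum>i\<in>{0..n - 1}. of_bool (z' i > 0 \<and> \<not> z' (i - 1) > 0) - of_bool (z i > 0 \<and> \<not> z (i - 1) > 0))
      = (\<Sum>i\<in>{0..n - 1}. ?f i - ?f (i - 1))" by simp
  also have "\<dots> = 0"
    using periodic_sum_Suc[of "\<lambda>i. ?f (i - 1)" n] assms(1) assms(2)[of "_ - 1"] assms(2)[of "_ - 1 - 1"] assms(3)[of "_ - 1"]
    by (simp add: sum_subtractf algebra_simps)
  finally show ?thesis by (simp add: sum_subtractf)
qed

lemma critical_index_eq:
  "critical_index W \<xi> = 1 - (\<Sum>i\<in>{0..int (length W) - 1}. of_bool (\<xi> \<bullet> vtx W i > 0 \<and> \<not> \<xi> \<bullet> vtx W (i - 1) > 0))"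
proof -
  have "{i \<in> {0..<int (length W)}. \<xi> \<bullet> vtx W i > 0 \<and> \<xi> \<bullet> vtx W (i - 1) \<le> 0}
      = {0..int (length W) - 1} \<inter> {i. \<xi> \<bullet> vtx W i > 0 \<and> \<not> \<xi> \<bullet> vtx W (i - 1) > 0}"
    by auto
  then show ?thesis by (simp add: critical_index_def sum_of_bool_eq)
qed

text \<open>A polar vertex parallel to \<open>\<xi>\<close> has no longitude about
  \<open>\<xi>\<close>. It would require two consecutive vertices of height 0, against
  admissibility.\<close>

lemma admissible_edge:
  assumes "admissible W \<xi>" "vtx W i \<times> vtx W (i + 1) \<noteq> 0"
  shows "(vtx W i \<times> vtx W (i + 1)) \<times> \<xi> \<noteq> 0"
proof
  let ?a = "vtx W i" and ?b = "vtx W (i + 1)"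
  assume "(?a \<times> ?b) \<times> \<xi> = 0"
  moreover have "(?a \<times> ?b) \<times> \<xi> = (\<xi> \<bullet> ?a) *\<^sub>R ?b - (\<xi> \<bullet> ?b) *\<^sub>R ?a"
    by (simp add: vec_eq_iff forall_3 cross3_def inner_vec_def sum_3 algebra_simps)
  ultimately have e: "(\<xi> \<bullet> ?a) *\<^sub>R ?b = (\<xi> \<bullet> ?b) *\<^sub>R ?a" by simp
  have "(\<xi> \<bullet> ?a) *\<^sub>R (?a \<times> ?b) = 0"
    using arg_cong[OF e, of "\<lambda>x. ?a \<times> x"] by (simp add: cross_mult_right)
  then have z: "\<xi> \<bullet> ?a = 0" using assms(2) by simp
  then have "(\<xi> \<bullet> vtx W (i - 1)) * (\<xi> \<bullet> ?b) < 0" using assms(1) by (simp add: admissible_def)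
  then have "?a = 0" using e z by auto
  then show False using assms(2) by simp
qed

text \<open>If \<open>b\<close> lies on the great circle, admissibility makes \<open>b\<close> non-extremal, so the term vanishes
  before and after the perturbation.\<close>

lemma crossing_term_stable:
  assumes "triple a b (\<xi> \<times> f) \<noteq> 0" "triple b c (\<xi> \<times> f) \<noteq> 0"
    and D: "triple a b (\<xi>' \<times> f') * triple a b (\<xi> \<times> f) > 0" "triple b c (\<xi>' \<times> f') * triple b c (\<xi> \<times> f) > 0"
    and z: "\<xi> \<bullet> b \<noteq> 0 \<Longrightarrow> (\<xi>' \<bullet> b) * (\<xi> \<bullet> b) > 0" "\<xi> \<bullet> b = 0 \<Longrightarrow> (\<xi> \<bullet> a) * (\<xi> \<bullet> c) < 0"
  shows "crossing_term \<xi>' (\<xi>' \<times> f') a b c = crossing_term \<xi> (\<xi> \<times> f) a b c"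
proof (cases "\<xi> \<bullet> b = 0")
  case True
  have "triple a b (\<xi> \<times> f) = (\<xi> \<bullet> a) * (f \<bullet> b)" "triple b c (\<xi> \<times> f) = - ((\<xi> \<bullet> c) * (f \<bullet> b))"
    using True by (simp_all add: triple_cross)
  then have "triple a b (\<xi> \<times> f) * triple b c (\<xi> \<times> f) > 0"
    using z(2)[OF True] assms(1) by (auto simp: zero_less_mult_iff mult_less_0_iff neq_iff)
  then have "\<not> triple a b (\<xi> \<times> f) * triple b c (\<xi> \<times> f) < 0" "\<not> triple a b (\<xi>' \<times> f') * triple b c (\<xi>' \<times> f') < 0"
    using D by (auto simp: zero_less_mult_iff mult_less_0_iff)
  then show ?thesis by (simp add: crossing_term_def)
next
  case False
  have "triple a b (\<xi>' \<times> f') * triple b c (\<xi>' \<times> f') < 0 \<longleftrightarrow> triple a b (\<xi> \<times> f) * triple b c (\<xi> \<times> f) < 0"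
    using D by (auto simp: zero_less_mult_iff mult_less_0_iff)
  moreover have "isgn (\<xi>' \<bullet> b) = isgn (\<xi> \<bullet> b)" "isgn (triple b c (\<xi>' \<times> f')) = isgn (triple b c (\<xi> \<times> f))"
    using D z(1)[OF False] by (auto simp: isgn_if zero_less_mult_iff)
  moreover have "x > 0 \<longleftrightarrow> isgn x > 0" for x by (simp add: isgn_if)
  ultimately show ?thesis unfolding crossing_term_def by (metis isgn_mult)
qed

lemma normal_degree_bound:
  assumes sph: "spherical_polygon W" and simple: "simple_polygon W" and gen: "general_position W"
    and "\<xi> \<in> sphere 0 1" and adm: "admissible W \<xi>"
  shows "\<bar>normal_degree W \<xi>\<bar> \<le> \<bar>critical_index W \<xi>\<bar>" "even (normal_degree W \<xi> - critical_index W \<xi>)"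
proof -
  let ?n = "int (length W)" and ?w = "vtx W"
  have \<xi>: "norm \<xi> = 1" using assms by simp
  have n: "3 \<le> ?n" and W: "W \<noteq> []" and S: "set W \<subseteq> sphere 0 1"
    using sph by (auto simp: spherical_polygon_def)
  have gp: "triple (?w i) (?w j) (?w k) \<noteq> 0"
    if "i mod ?n \<noteq> j mod ?n" "j mod ?n \<noteq> k mod ?n" "i mod ?n \<noteq> k mod ?n" for i j k
    using general_position_triple[OF gen S W that] .
  have neq: "i mod ?n \<noteq> (i + 1) mod ?n" "i mod ?n \<noteq> (i + 2) mod ?n" "(i + 1) mod ?n \<noteq> (i + 2) mod ?n" for i
    using n by (auto simp: mod_eq_dvd_iff zdvd_not_zless)
  have bend: "triple (?w i) (?w (i + 1)) (?w (i + 2)) \<noteq> 0" for i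
    using gp[of i "i + 1" "i + 2"] neq[of i] by simp
  have per: "?w (i + ?n) = ?w i" for i by (rule vtx_periodic)
  have red: "\<exists>j\<in>{0..?n - 1}. j mod ?n = i mod ?n \<and> ?w i = ?w j \<and> ?w (i + 1) = ?w (j + 1)" for i
    using W pos_mod_bound[of ?n i] pos_mod_sign[of ?n i]
    by (intro bexI[of _ "i mod ?n"]) (auto intro!: vtx_cong simp: mod_add_left_eq)
  let ?F = "(\<lambda>i. ?w i \<times> ?w (i + 1)) ` {0..?n - 1}"
  have edge: "?w i \<times> ?w (i + 1) \<noteq> 0" for i
    using bend[of i] by (auto simp: triple_def)
  have "x \<times> \<xi> \<noteq> 0" if "x \<in> ?F" for x
    using that admissible_edge[OF adm edge] by auto
  then obtain f where f: "norm f = 1" "\<xi> \<bullet> f = 0" and fF: "\<And>x. x \<in> ?F \<Longrightarrow> triple f x \<xi> \<noteq> 0"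
    using perp_unit_avoiding[OF \<xi>, of ?F] W by auto
  have fD: "triple (?w i) (?w (i + 1)) (\<xi> \<times> f) \<noteq> 0" for i
  proof -
    obtain j where j: "j \<in> {0..?n - 1}" "?w i = ?w j" "?w (i + 1) = ?w (j + 1)"
      using red[of i] by blast
    have "triple f (?w j \<times> ?w (j + 1)) \<xi> \<noteq> 0" using j(1) by (intro fF imageI)
    then show ?thesis unfolding j(2,3) by (simp add: triple_cross_left)
  qed

  \<comment> \<open>On the open set \<open>?U\<close> the edge determinants and the nonzero heights
    keep their signs. The perturbed pair need not be orthonormal, since the axis
    \<open>\<xi>' \<times> f'\<close> is orthogonal to \<open>\<xi>'\<close> anyway.\<close>
  let ?D = "\<lambda>i p. triple (?w i) (?w (i + 1)) (fst p \<times> snd p)"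
  let ?U = "(\<Inter>i\<in>{0..?n - 1}. {p. 0 < ?D i p * ?D i (\<xi>, f)}) \<inter>
    (\<Inter>i\<in>{i \<in> {0..?n - 1}. \<xi> \<bullet> ?w i \<noteq> 0}. {p. 0 < (fst p \<bullet> ?w i) * (\<xi> \<bullet> ?w i)})"
  have "open ?U"
    unfolding triple_cross
    by (intro open_Int open_INT finite_atLeastAtMost_int ballI open_Collect_less continuous_intros finite_Collect_conjI) auto
  moreover have "(\<xi>, f) \<in> ?U"
    using fD by (auto simp: zero_less_mult_iff neq_iff)
  ultimately obtain A B where AB: "open A" "open B" "(\<xi>, f) \<in> Sigma A (\<lambda>_. B)" "Sigma A (\<lambda>_. B) \<subseteq> ?U"
    by (rule open_prod_elim)
  have "?w i \<noteq> 0" for i using bend[of i] by (auto simp: triple_def)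
  then have "\<exists>x\<in>A. \<forall>y\<in>?w ` {0..?n - 1}. x \<bullet> y \<noteq> 0"
    using AB by (intro open_avoid_hyperplanes) auto
  then obtain \<xi>' where \<xi>': "\<xi>' \<in> A" "\<And>i. i \<in> {0..?n - 1} \<Longrightarrow> \<xi>' \<bullet> ?w i \<noteq> 0" by blast
  have h: "\<xi>' \<bullet> ?w i \<noteq> 0" for i using red[of i] \<xi>'(2) by metis
  let ?P = "{(i, j) \<in> Sigma {0..?n - 1} (\<lambda>_. {0..?n - 1}). i mod ?n \<noteq> j mod ?n}"
  \<comment> \<open>The inner product of \<open>f'\<close> with \<open>?y (i, j)\<close> is
    \<open>triple (?w i) (?w j) (\<xi>' \<times> f')\<close>. That \<open>?y (i, j)\<close> is
    nonzero follows from a third vertex \<open>k\<close> and general position.\<close>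
  let ?y = "\<lambda>(i, j). (\<xi>' \<bullet> ?w i) *\<^sub>R ?w j - (\<xi>' \<bullet> ?w j) *\<^sub>R ?w i"
  have "?y ij \<noteq> 0" if P: "ij \<in> ?P" for ij
  proof -
    obtain i j where ij: "ij = (i, j)" "i mod ?n \<noteq> j mod ?n" using P by blast
    obtain k where k: "k mod ?n \<noteq> i mod ?n" "k mod ?n \<noteq> j mod ?n"
      using neq[of i] by metis
    have "triple (?w i) (?w j) (?w k) \<noteq> 0" using gp ij k by metis
    moreover have "triple (?w i) (?y ij) (?w k) = (\<xi>' \<bullet> ?w i) * triple (?w i) (?w j) (?w k)"
      unfolding ij by (simp add: triple_expand algebra_simps)
    ultimately have "triple (?w i) (?y ij) (?w k) \<noteq> 0" using h by simp
    then show ?thesis by (auto simp: triple_def)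
  qed
  moreover have "finite ?P" by (rule finite_subset[of _ "Sigma {0..?n - 1} (\<lambda>_. {0..?n - 1})"]) auto
  ultimately have "\<exists>x\<in>B. \<forall>y\<in>?y ` ?P. x \<bullet> y \<noteq> 0"
    using AB by (intro open_avoid_hyperplanes) (auto simp del: case_prod_conv)
  then obtain f' where f': "f' \<in> B" "\<And>ij. ij \<in> ?P \<Longrightarrow> f' \<bullet> ?y ij \<noteq> 0" by blast
  have U: "(\<xi>', f') \<in> ?U" using \<xi>'(1) f'(1) AB by blast
  then have D: "0 < ?D i (\<xi>', f') * ?D i (\<xi>, f)" and z: "\<xi> \<bullet> ?w i \<noteq> 0 \<Longrightarrow> 0 < (\<xi>' \<bullet> ?w i) * (\<xi> \<bullet> ?w i)" for i
  proof -
    obtain j where j: "j \<in> {0..?n - 1}" "?w i = ?w j" "?w (i + 1) = ?w (j + 1)"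
      using red[of i] by blast
    show "0 < ?D i (\<xi>', f') * ?D i (\<xi>, f)"
      using U j(1) unfolding j(2,3) by blast
    show "0 < (\<xi>' \<bullet> ?w i) * (\<xi> \<bullet> ?w i)" if "\<xi> \<bullet> ?w i \<noteq> 0"
      using U j(1) that unfolding j(2,3) by auto
  qed
  have gen2: "triple (?w i) (?w j) (\<xi>' \<times> f') \<noteq> 0" if "i mod ?n \<noteq> j mod ?n" for i j
  proof -
    obtain i' where i': "i' \<in> {0..?n - 1}" "i' mod ?n = i mod ?n" "?w i = ?w i'" using red[of i] by blast
    obtain j' where j': "j' \<in> {0..?n - 1}" "j' mod ?n = j mod ?n" "?w j = ?w j'" using red[of j] by blast
    have "f' \<bullet> ?y (i', j') \<noteq> 0" using i' j' that by (intro f'(2)) auto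
    then show ?thesis using i' j' by (simp add: triple_cross inner_diff_right algebra_simps)
  qed
  interpret generic_polygon ?w ?n \<xi>' "\<xi>' \<times> f'"
  proof
    fix i j assume ij: "i mod ?n \<noteq> j mod ?n" "(i + 1) mod ?n \<noteq> j mod ?n" "(j + 1) mod ?n \<noteq> i mod ?n"
    have "(i + 1) mod ?n \<noteq> (j + 1) mod ?n" using ij(1) by (simp add: mod_eq_dvd_iff)
    then show "\<not> arcs_cross (?w i) (?w (i + 1)) (?w j) (?w (j + 1))"
      using ij neq(1)[of i] neq(1)[of j]
      by (intro simple_polygon_no_crossing[OF simple W] gp) auto
  qed (use n per gp gen2 h in \<open>auto simp: dot_cross_self inner_commute\<close>)
  have adm': "\<xi> \<bullet> ?w i = 0 \<Longrightarrow> (\<xi> \<bullet> ?w (i - 1)) * (\<xi> \<bullet> ?w (i + 1)) < 0" for i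
    using adm by (simp add: admissible_def)
  have "normal_degree W \<xi> = crossing_total"
    unfolding crossing_total_def normal_degree_eq[OF W bend \<xi> adm f fD]
  proof (intro sum.cong refl crossing_term_stable[symmetric])
    fix i
    show "triple (?w (i - 1)) (?w i) (\<xi> \<times> f) \<noteq> 0" "triple (?w i) (?w (i + 1)) (\<xi> \<times> f) \<noteq> 0"
      using fD[of "i - 1"] fD[of i] by simp_all
    show "0 < triple (?w (i - 1)) (?w i) (\<xi>' \<times> f') * triple (?w (i - 1)) (?w i) (\<xi> \<times> f)"
      "0 < triple (?w i) (?w (i + 1)) (\<xi>' \<times> f') * triple (?w i) (?w (i + 1)) (\<xi> \<times> f)"
      using D[of "i - 1"] D[of i] by simp_all
  qed (use z adm' in auto)
  moreover have "critical_index W \<xi> = 1 - upcrossings"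
    unfolding critical_index_eq upcrossings_def
    using upcrossings_perturb[of ?n "\<lambda>i. \<xi> \<bullet> ?w i" "\<lambda>i. \<xi>' \<bullet> ?w i"] W per z adm' by simp
  ultimately show "\<bar>normal_degree W \<xi>\<bar> \<le> \<bar>critical_index W \<xi>\<bar>" "even (normal_degree W \<xi> - critical_index W \<xi>)"
    using crossing_total_bound by simp_all
qed

section \<open>Zigzag polygons\<close>

text \<open>A nonzero determinant excludes equal or antipodal neighbours. For polar edges the
  determinant with the common vertex \<open>vtx W (i + 1)\<close> is used, again a multiple of the
  bend.\<close>

lemma spherical_polygon_bend:
  assumes "3 \<le> length W" "set W \<subseteq> sphere 0 1"
    and bend: "\<And>i. triple (vtx W i) (vtx W (i + 1)) (vtx W (i + 2)) \<noteq> 0"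
  shows "spherical_polygon W" "spherical_polygon (polar_polygon W)"
proof -
  have ne: "y \<noteq> x \<and> y \<noteq> - x" if "triple x y z \<noteq> 0" for x y z
    using that triple_scale(2)[of x "-1" x z] by auto
  show "spherical_polygon W"
    using assms ne[OF bend] by (simp add: spherical_polygon_def)
  have W: "W \<noteq> []" using assms(1) by auto
  have edge: "vtx W i \<times> vtx W (i + 1) \<noteq> 0" for i
    using bend[of i] by (auto simp: triple_def)
  have "set (polar_polygon W) \<subseteq> sphere 0 1"
    using edge by (auto simp: polar_polygon_def)
  moreover have "triple (vtx (polar_polygon W) i) (vtx (polar_polygon W) (i + 1)) (vtx W (i + 1)) \<noteq> 0" for i
  proof -
    have suc2: "i + 1 + 1 = i + 2" by simp
    have "triple (vtx W i \<times> vtx W (i + 1)) (vtx W (i + 1) \<times> vtx W (i + 2)) (vtx W (i + 1))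
      = triple (vtx W i) (vtx W (i + 1)) (vtx W (i + 2)) * (vtx W (i + 1) \<bullet> vtx W (i + 1))"
      by (rule triple_cross_left)
    then show ?thesis
      using bend[of i] edge[of i] edge[of "i + 1"] unfolding vtx_polar[OF W] suc2 by auto
  qed
  ultimately show "spherical_polygon (polar_polygon W)"
    using assms(1) ne by (simp add: spherical_polygon_def) blast
qed

section \<open>The gnomonic chart, in which great circle arcs become segments\<close>

definition chart :: "real \<Rightarrow> real \<Rightarrow> real^3" where
  "chart x y = vector [1, x, y]"

lemma chart_nth [simp]: "chart x y $ 1 = 1" "chart x y $ 2 = x" "chart x y $ 3 = y"
  by (simp_all add: chart_def)

lemma norm_chart_pos: "norm (chart x y) > 0"
  using chart_nth(1)[of x y] by (metis zero_index zero_less_norm_iff zero_neq_one)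

abbreviation "north \<equiv> vector [0, 0, 1] :: real^3"
abbreviation "front \<equiv> vector [1, 0, 0] :: real^3"

lemma north_front: "norm north = 1" "norm front = 1" "north \<bullet> front = 0"
  by (simp_all add: norm_eq_1 inner_vec_def sum_3)

definition orient :: "real \<Rightarrow> real \<Rightarrow> real \<Rightarrow> real \<Rightarrow> real \<Rightarrow> real \<Rightarrow> real" where
  "orient xa ya xb yb xc yc = (xb - xa) * (yc - ya) - (xc - xa) * (yb - ya)"

lemma triple_chart: "triple (chart xa ya) (chart xb yb) (chart xc yc) = orient xa ya xb yb xc yc"
  by (simp add: triple_expand orient_def algebra_simps)

text \<open>Here \<open>north \<times> front\<close> is the second coordinate axis. About it the
  longitude of a chart point depends only on \<open>y\<close>, so extremal vertices are local
  extrema of the height in the chart.\<close>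

lemma triple_chart_axis: "triple (chart xa ya) (chart xb yb) (north \<times> front) = ya - yb"
  by (simp add: triple_expand cross3_def)

lemma north_chart: "north \<bullet> chart x y = y"
  by (simp add: inner_vec_def sum_3)

lemma crossing_term_isgn:
  "crossing_term \<xi> v a b c =
     (if isgn (triple a b v) * isgn (triple b c v) < 0 \<and>
         isgn (triple b c v) * (isgn (triple a b c) * isgn (\<xi> \<bullet> b)) > 0
      then isgn (triple a b c) * isgn (\<xi> \<bullet> b) else 0)"
proof -
  have "x < 0 \<longleftrightarrow> isgn x < 0" "x > 0 \<longleftrightarrow> isgn x > 0" for x by (simp_all add: isgn_if)
  then show ?thesis unfolding crossing_term_def isgn_mult[symmetric] by presburger
qed

lemma crossing_term_scale:
  assumes "r > 0" "s > 0" "t > 0"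
  shows "crossing_term \<xi> v (r *\<^sub>R a) (s *\<^sub>R b) (t *\<^sub>R c) = crossing_term \<xi> v a b c"
  using assms by (simp add: crossing_term_isgn isgn_mult)

text \<open>Division by the first coordinate makes the nonnegative combination convex, with weight
  \<open>T / (S + T)\<close>; excluding the end point gives \<open>t < 1\<close>.\<close>

lemma great_arc_chart:
  fixes a b :: "real^3"
  assumes a: "a $ 1 = 1" and b: "b $ 1 = 1"
    and x: "x \<in> great_arc (a /\<^sub>R norm a) (b /\<^sub>R norm b)" "x \<noteq> b /\<^sub>R norm b"
  shows "\<exists>t. 0 \<le> t \<and> t < 1 \<and> (\<forall>k. x $ k / x $ 1 = (1 - t) * a $ k + t * b $ k)"
proof -
  obtain s t where st: "s \<ge> 0" "t \<ge> 0" "x = s *\<^sub>R (a /\<^sub>R norm a) + t *\<^sub>R (b /\<^sub>R norm b)" and nx: "norm x = 1"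
    using x(1) by (auto simp: great_arc_def)
  have na: "norm a > 0" and nb: "norm b > 0" using a b by auto
  have "s \<noteq> 0"
  proof
    assume "s = 0"
    then have "norm x = t" using st nb by simp
    then have "t = 1" using nx by simp
    then show False using \<open>s = 0\<close> st x(2) by simp
  qed
  define S T where "S = s / norm a" and "T = t / norm b"
  have S: "S > 0" "T \<ge> 0" using \<open>s \<noteq> 0\<close> st(1,2) na nb by (simp_all add: S_def T_def)
  have xk: "x $ k = S * a $ k + T * b $ k" for k
    by (simp add: st(3) S_def T_def field_simps)
  then have "x $ 1 = S + T" using a b by simp
  moreover have "1 - T / (S + T) = S / (S + T)" using S by (simp add: field_simps)
  ultimately show ?thesis
    using S xk by (intro exI[of _ "T / (S + T)"]) (simp add: add_divide_distrib)
qed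

text \<open>The first zigzag runs to the right from 0 to \<open>2 * p + 1\<close>, the second to the
  left from -1 to \<open>- 2 * q - 2\<close>.\<close>

definition zigzag_x :: "int \<Rightarrow> int \<Rightarrow> real" where
  "zigzag_x p j = (if j \<le> 2 * p + 1 then of_int j else of_int (2 * p + 1 - j))"

text \<open>Inner vertices alternate between 1 and -1. The heights of absolute value 2 and 3 lead
  the two long connecting edges below and above the zigzags, and make the starting points of these
  edges non-extremal.\<close>

definition zigzag_y :: "int \<Rightarrow> int \<Rightarrow> int \<Rightarrow> real" where
  "zigzag_y p q j =
     (if j = 0 then 3 else if j = 2 * p + 1 then -2 else if j = 2 * p + 2 then -3
      else if j = 2 * p + 2 * q + 3 then 2 else if even j \<longleftrightarrow> j \<le> 2 * p then 1 else -1)"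

definition zigzag_point :: "int \<Rightarrow> int \<Rightarrow> int \<Rightarrow> real^3" where
  "zigzag_point p q j = chart (zigzag_x p j) (zigzag_y p q j)"

definition zigzag :: "int \<Rightarrow> int \<Rightarrow> (real^3) list" where
  "zigzag p q = map (\<lambda>j. zigzag_point p q j /\<^sub>R norm (zigzag_point p q j)) [0..(2 * p + 2 * q + 4) - 1]"

lemma card_odd_between: "card {j::int. odd j \<and> 2 * a < j \<and> j < 2 * b} = nat (b - a)"
proof -
  have "{j. odd j \<and> 2 * a < j \<and> j < 2 * b} = (\<lambda>k. 2 * k + 1) ` {a..<b}"
    by (auto elim!: oddE simp: image_iff)
  then show ?thesis by (simp add: card_image inj_on_def)
qed

lemma card_even_between: "card {j::int. even j \<and> 2 * a < j \<and> j < 2 * b} = nat (b - a - 1)"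
proof -
  have "{j. even j \<and> 2 * a < j \<and> j < 2 * b} = (\<lambda>k. 2 * k) ` {a<..<b}"
    by (auto elim!: evenE simp: image_iff)
  then show ?thesis by (simp add: card_image inj_on_def)
qed

section \<open>Turns, index, degree and simplicity of the zigzag polygon\<close>

locale zigzag_polygon =
  fixes p q :: int
  assumes p0: "0 \<le> p" and q0: "0 \<le> q"
begin

abbreviation "n \<equiv> 2 * p + 2 * q + 4"
abbreviation "X \<equiv> zigzag_x p"
abbreviation "Y \<equiv> zigzag_y p q"
abbreviation "V \<equiv> zigzag_point p q"
abbreviation "nxt j \<equiv> if j = n - 1 then 0 else j + 1"
abbreviation "prv j \<equiv> if j = 0 then n - 1 else j - (1::int)"

lemma Y_signs:
  assumes "0 \<le> j" "j < n"
  shows "j \<le> 2 * p + 1 \<Longrightarrow> even j \<Longrightarrow> Y j \<ge> 1" "j \<le> 2 * p + 1 \<Longrightarrow> odd j \<Longrightarrow> Y j \<le> -1"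
    "2 * p + 2 \<le> j \<Longrightarrow> even j \<Longrightarrow> Y j \<le> -1" "2 * p + 2 \<le> j \<Longrightarrow> odd j \<Longrightarrow> Y j \<ge> 1"
  using assms p0 q0 by (auto simp: zigzag_y_def) presburger+

lemma Y_inner:
  "0 < j \<Longrightarrow> j \<le> 2 * p \<Longrightarrow> Y j = (if even j then 1 else -1)"
  "2 * p + 2 < j \<Longrightarrow> j < n - 1 \<Longrightarrow> Y j = (if even j then -1 else 1)"
  using p0 q0 by (auto simp: zigzag_y_def)

lemma Y_special: "Y 0 = 3" "Y (2 * p + 1) = -2" "Y (2 * p + 2) = -3" "Y (n - 1) = 2"
  using p0 q0 by (auto simp: zigzag_y_def)

lemma index_cases:
  assumes "0 \<le> j" "j < n"
  obtains "j = 0" | "0 < j" "j \<le> 2 * p" | "j = 2 * p + 1" | "j = 2 * p + 2"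
    | "2 * p + 2 < j" "j < n - 1" | "j = n - 1"
  using assms by linarith

abbreviation "bend j \<equiv> orient (X (prv j)) (Y (prv j)) (X j) (Y j) (X (nxt j)) (Y (nxt j))"

text \<open>Inner odd vertices are minima of the zigzag run to the right and maxima of the one run
  to the left, hence left turns in both. Inner even vertices and the four ends of the long edges are
  right turns.\<close>

lemma bend_signs:
  assumes "0 \<le> j" "j < n"
  shows "if odd j \<and> (j \<le> 2 * p \<or> 2 * p + 2 < j \<and> j < n - 1) then bend j > 0 else bend j < 0"
  using assms
proof (cases rule: index_cases)
  case 1
  have "Y 1 \<le> -1" using Y_signs(2)[of 1] p0 q0 by simp
  moreover have "X (n - 1) = - of_int (2 * q + 2)" "X 0 = 0" "X 1 = 1"
    using p0 q0 by (auto simp: zigzag_x_def)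
  moreover have "(2 * of_int q + 2) * (Y 1 - 2) \<le> 0"
    using \<open>Y 1 \<le> -1\<close> q0 by (intro mult_nonneg_nonpos) auto
  moreover have "bend j = orient (- of_int (2 * q + 2)) 2 0 3 1 (Y 1)"
  proof -
    have "prv j = n - 1" "nxt j = 1" using 1 p0 q0 by auto
    then show ?thesis
      using calculation(2-4) Y_special unfolding 1 by (simp only:)
  qed
  moreover have "orient (- of_int (2 * q + 2)) 2 0 3 1 (Y 1) < 0"
    using calculation(1,5) q0 p0 by (simp add: orient_def algebra_simps)
  ultimately have "bend j < 0" by (simp only:)
  moreover have "\<not> (odd j \<and> (j \<le> 2 * p \<or> 2 * p + 2 < j \<and> j < n - 1))"
    using 1 p0 q0 by auto
  ultimately show ?thesis by (simp only: if_False)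
next
  case 2
  have X: "X (j - 1) = of_int j - 1" "X j = of_int j" "X (j + 1) = of_int j + 1"
    using 2 by (auto simp: zigzag_x_def)
  have b: "bend j = Y (j + 1) + Y (j - 1) - 2 * Y j"
  proof -
    have "bend j = orient (of_int j - 1) (Y (j - 1)) (of_int j) (Y j) (of_int j + 1) (Y (j + 1))"
      using 2 q0 X by simp
    then show ?thesis by (simp add: orient_def algebra_simps)
  qed
  show ?thesis
  proof (cases "even j")
    case True
    then show ?thesis unfolding b
      using 2 q0 Y_inner(1)[of j] Y_signs(2)[of "j - 1"] Y_signs(2)[of "j + 1"] by auto
  next
    case False
    then show ?thesis unfolding b
      using 2 q0 Y_inner(1)[of j] Y_signs(1)[of "j - 1"] Y_signs(1)[of "j + 1"] by auto
  qed
next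
  case 3
  have "Y (2 * p) \<ge> 1" using Y_signs(1)[of "2 * p"] p0 q0 by simp
  moreover have "X (2 * p) = 2 * of_int p" "X (2 * p + 1) = 2 * of_int p + 1" "X (2 * p + 2) = -1"
    by (auto simp: zigzag_x_def)
  moreover have "(2 * of_int p + 1) * (- 2 - Y (2 * p)) \<le> 0"
    using \<open>Y (2 * p) \<ge> 1\<close> p0 by (intro mult_nonneg_nonpos) auto
  moreover have "bend j = orient (2 * of_int p) (Y (2 * p)) (2 * of_int p + 1) (-2) (-1) (-3)"
  proof -
    have "prv j = 2 * p" "nxt j = 2 * p + 2" using 3 p0 q0 by auto
    then show ?thesis
      using calculation(2-4) Y_special unfolding 3 by (simp only:)
  qed
  moreover have "orient (2 * of_int p) (Y (2 * p)) (2 * of_int p + 1) (-2) (-1) (-3) < 0"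
    using calculation(1,5) q0 p0 by (simp add: orient_def algebra_simps)
  ultimately have "bend j < 0" by (simp only:)
  moreover have "\<not> (odd j \<and> (j \<le> 2 * p \<or> 2 * p + 2 < j \<and> j < n - 1))"
    using 3 p0 q0 by auto
  ultimately show ?thesis by (simp only: if_False)
next
  case 4
  have "Y (2 * p + 3) \<ge> 1" using Y_signs(4)[of "2 * p + 3"] p0 q0 by simp
  moreover have "X (2 * p + 3) = -2" "X (2 * p + 1) = 2 * of_int p + 1" "X (2 * p + 2) = -1"
    by (auto simp: zigzag_x_def)
  moreover have "(2 * of_int p + 2) * (Y (2 * p + 3) + 2) \<ge> 0"
    using \<open>Y (2 * p + 3) \<ge> 1\<close> p0 by (intro mult_nonneg_nonneg) auto
  moreover have "bend j = orient (2 * of_int p + 1) (-2) (-1) (-3) (-2) (Y (2 * p + 3))"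
  proof -
    have "prv j = 2 * p + 1" "nxt j = 2 * p + 3" using 4 p0 q0 by auto
    then show ?thesis
      using calculation(2-4) Y_special unfolding 4 by (simp only:)
  qed
  moreover have "orient (2 * of_int p + 1) (-2) (-1) (-3) (-2) (Y (2 * p + 3)) < 0"
  proof -
    have "orient (2 * of_int p + 1) (-2) (-1) (-3) (-2) (Y (2 * p + 3))
        = - ((2 * of_int p + 2) * (Y (2 * p + 3) + 2)) - (2 * of_int p + 3)"
      by (simp add: orient_def algebra_simps)
    moreover have "real_of_int p \<ge> 0" using p0 by simp
    ultimately show ?thesis
      using \<open>(2 * of_int p + 2) * (Y (2 * p + 3) + 2) \<ge> 0\<close> by linarith
  qed
  ultimately have "bend j < 0" by (simp only:)
  moreover have "\<not> (odd j \<and> (j \<le> 2 * p \<or> 2 * p + 2 < j \<and> j < n - 1))"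
    using 4 p0 q0 by auto
  ultimately show ?thesis by (simp only: if_False)
next
  case 5
  have X: "X (j - 1) = 2 * of_int p + 2 - of_int j" "X j = 2 * of_int p + 1 - of_int j" "X (j + 1) = 2 * of_int p - of_int j"
    using 5 by (auto simp: zigzag_x_def)
  have b: "bend j = 2 * Y j - Y (j + 1) - Y (j - 1)"
  proof -
    have "bend j = orient (2 * of_int p + 2 - of_int j) (Y (j - 1)) (2 * of_int p + 1 - of_int j) (Y j)
        (2 * of_int p - of_int j) (Y (j + 1))"
      using 5 p0 q0 X by simp
    then show ?thesis by (simp add: orient_def algebra_simps)
  qed
  show ?thesis
  proof (cases "even j")
    case True
    then show ?thesis unfolding b
      using 5 q0 p0 Y_inner(2)[of j] Y_signs(4)[of "j - 1"] Y_signs(4)[of "j + 1"] by auto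
  next
    case False
    then show ?thesis unfolding b
      using 5 q0 p0 Y_inner(2)[of j] Y_signs(3)[of "j - 1"] Y_signs(3)[of "j + 1"] by auto
  qed
next
  case 6
  have "Y (n - 2) \<le> -1" using Y_signs(3)[of "n - 2"] p0 q0 by simp
  moreover have "X (n - 1) = - 2 * of_int q - 2" "X 0 = 0" "X (n - 2) = - 2 * of_int q - 1"
    using p0 q0 by (auto simp: zigzag_x_def)
  moreover have "(2 * of_int q + 1) * (Y (n - 2) - 2) \<le> 0"
    using \<open>Y (n - 2) \<le> -1\<close> q0 by (intro mult_nonneg_nonpos) auto
  moreover have "bend j = orient (- 2 * of_int q - 1) (Y (n - 2)) (- 2 * of_int q - 2) 2 0 3"
  proof -
    have "prv j = n - 2" "nxt j = 0" using 6 p0 q0 by auto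
    then show ?thesis
      using calculation(2-4) Y_special unfolding 6 by (simp only:)
  qed
  moreover have "orient (- 2 * of_int q - 1) (Y (n - 2)) (- 2 * of_int q - 2) 2 0 3 < 0"
    using calculation(1,5) q0 p0 by (simp add: orient_def algebra_simps)
  ultimately have "bend j < 0" by (simp only:)
  moreover have "\<not> (odd j \<and> (j \<le> 2 * p \<or> 2 * p + 2 < j \<and> j < n - 1))"
    using 6 p0 q0 by auto
  ultimately show ?thesis by (simp only: if_False)
qed


abbreviation "contribution j \<equiv> crossing_term north (north \<times> front) (V (prv j)) (V j) (V (nxt j))"

text \<open>Every extremal vertex is a peak above or a trough below the great circle, so its term
  survives only at a left turn and has the sign of \<open>Y j\<close> there: negative in the first
  zigzag, positive in the second.\<close>

lemma crossing_term_zigzag: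
  assumes "0 \<le> j" "j < n"
  shows "contribution j = of_bool (odd j \<and> 2 * p + 2 < j \<and> j < n - 1) - of_bool (odd j \<and> j \<le> 2 * p)"
proof -
  have t: "contribution j = (if (Y (prv j) - Y j) * (Y j - Y (nxt j)) < 0 \<and>
      (Y j - Y (nxt j)) * (bend j * Y j) > 0 then isgn (bend j * Y j) else 0)"
    by (simp only: crossing_term_def zigzag_point_def triple_chart_axis triple_chart north_chart)
  have nz: "contribution j = 0" if "bend j < 0" "Y j * (Y j - Y (nxt j)) > 0"
  proof -
    have "(Y j - Y (nxt j)) * (bend j * Y j) = bend j * (Y j * (Y j - Y (nxt j)))" by (simp only: ac_simps)
    then have "\<not> (Y j - Y (nxt j)) * (bend j * Y j) > 0"
      using mult_neg_pos[OF that] by linarith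
    then show ?thesis unfolding t by (simp only: if_False simp_thms)
  qed
  have pz: "contribution j = 0" if "(Y (prv j) - Y j) * (Y j - Y (nxt j)) > 0"
    using that unfolding t by (auto simp del: if_split)
  note B = bend_signs[OF assms]
  from assms show ?thesis
  proof (cases rule: index_cases)
    case 1
    have "Y 1 \<le> -1" using Y_signs(2)[of 1] p0 q0 by simp
    moreover have "nxt j = 1" using 1 p0 q0 by auto
    ultimately have "Y j * (Y j - Y (nxt j)) > 0" unfolding 1 Y_special(1) by simp
    moreover have "bend j < 0" using B 1 by simp
    ultimately have "contribution j = 0" by (intro nz)
    then show ?thesis using 1 p0 by simp
  next
    case 2
    have ne: "prv j = j - 1" "nxt j = j + 1" using 2 q0 by auto
    show ?thesis
    proof (cases "even j")
      case True
      have "Y j * (Y j - Y (nxt j)) > 0"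
        using True 2 q0 Y_inner(1)[of j] Y_signs(2)[of "j + 1"] unfolding ne by simp
      moreover have "bend j < 0" using B True by simp
      ultimately have "contribution j = 0" by (intro nz)
      then show ?thesis using True by simp
    next
      case False
      have Y: "Y j = -1" "Y (j - 1) \<ge> 1" "Y (j + 1) \<ge> 1"
        using False 2 q0 Y_inner(1)[of j] Y_signs(1)[of "j - 1"] Y_signs(1)[of "j + 1"] by auto
      have "bend j > 0" using B False 2 by simp
      then have "contribution j = -1" unfolding t using Y unfolding ne
        by (simp add: zero_less_mult_iff mult_less_0_iff isgn_mult)
      then show ?thesis using False 2 by simp
    qed
  next
    case 3
    have "prv j = 2 * p" "nxt j = 2 * p + 2" using 3 p0 q0 by auto
    moreover have "Y (2 * p) \<ge> 1" using Y_signs(1)[of "2 * p"] p0 q0 by simp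
    ultimately have "(Y (prv j) - Y j) * (Y j - Y (nxt j)) > 0"
      using Y_special 3 by simp
    then have "contribution j = 0" by (rule pz)
    then show ?thesis using 3 by simp
  next
    case 4
    have "nxt j = 2 * p + 3" using 4 p0 q0 by auto
    moreover have "Y (2 * p + 3) \<ge> 1" using Y_signs(4)[of "2 * p + 3"] p0 q0 by simp
    ultimately have "Y j * (Y j - Y (nxt j)) > 0"
      using Y_special 4 by (simp add: mult_neg_neg)
    moreover have "bend j < 0" using B 4 by simp
    ultimately have "contribution j = 0" by (intro nz)
    then show ?thesis using 4 by simp
  next
    case 5
    have ne: "prv j = j - 1" "nxt j = j + 1" using 5 p0 q0 by auto
    show ?thesis
    proof (cases "even j")
      case True
      have "Y j * (Y j - Y (nxt j)) > 0"
        using True 5 p0 q0 Y_inner(2)[of j] Y_signs(4)[of "j + 1"] unfolding ne by simp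
      moreover have "bend j < 0" using B True by simp
      ultimately have "contribution j = 0" by (intro nz)
      then show ?thesis using True by simp
    next
      case False
      have Y: "Y j = 1" "Y (j - 1) \<le> -1" "Y (j + 1) \<le> -1"
        using False 5 p0 q0 Y_inner(2)[of j] Y_signs(3)[of "j - 1"] Y_signs(3)[of "j + 1"] by auto
      have "bend j > 0" using B False 5 by simp
      then have "contribution j = 1" unfolding t using Y unfolding ne
        by (simp add: zero_less_mult_iff mult_less_0_iff isgn_mult)
      then show ?thesis using False 5 by simp
    qed
  next
    case 6
    have "prv j = n - 2" "nxt j = 0" using 6 p0 q0 by auto
    moreover have "Y (n - 2) \<le> -1" using Y_signs(3)[of "n - 2"] p0 q0 by simp
    ultimately have "(Y (prv j) - Y j) * (Y j - Y (nxt j)) > 0"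
      using Y_special 6 by (simp add: mult_neg_neg)
    then have "contribution j = 0" by (rule pz)
    then show ?thesis using 6 p0 q0 by simp
  qed
qed

abbreviation "W \<equiv> zigzag p q"

lemma length_zigzag: "int (length W) = n"
  using p0 q0 by (simp add: zigzag_def)

lemma vtx_zigzag: "vtx W i = V (i mod n) /\<^sub>R norm (V (i mod n))"
  unfolding zigzag_def by (rule vtx_map_upto) (use p0 q0 in simp)

lemma V_norm_pos: "norm (V j) > 0" "inverse (norm (V j)) > 0"
  by (simp_all only: zigzag_point_def norm_chart_pos positive_imp_inverse_positive)

lemma mod_neighbours: "(i + 1) mod n = nxt (i mod n)" "(i - 1) mod n = prv (i mod n)"
proof -
  have n: "n > 0" using p0 q0 by simp
  have r: "0 \<le> i mod n" "i mod n < n" using n by simp_all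
  show "(i + 1) mod n = nxt (i mod n)"
  proof (cases "i mod n = n - 1")
    case True
    have "(i + 1) mod n = (i mod n + 1) mod n" by (simp only: mod_add_left_eq)
    then show ?thesis unfolding True by (simp only: diff_add_cancel mod_self simp_thms if_True)
  next
    case False
    have "(i + 1) mod n = (i mod n + 1) mod n" by (simp only: mod_add_left_eq)
    then show ?thesis using False r by (simp add: mod_pos_pos_trivial)
  qed
  show "(i - 1) mod n = prv (i mod n)"
  proof (cases "i mod n = 0")
    case True
    have "(i - 1) mod n = (i mod n - 1) mod n" by (simp only: mod_diff_left_eq)
    then show ?thesis unfolding True using n by (simp add: zmod_minus1)
  next
    case False
    have "(i - 1) mod n = (i mod n - 1) mod n" by (simp only: mod_diff_left_eq)
    then show ?thesis using False r by (simp add: mod_pos_pos_trivial)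
  qed
qed

lemma range_mod: "0 \<le> i mod n" "i mod n < n"
  using p0 q0 by simp_all

lemma zigzag_bend: "triple (vtx W (i - 1)) (vtx W i) (vtx W (i + 1)) \<noteq> 0"
proof -
  have "bend (i mod n) \<noteq> 0"
    using bend_signs[OF range_mod, of i] by (auto split: if_splits)
  then show ?thesis
    using V_norm_pos unfolding vtx_zigzag mod_neighbours by (simp add: zigzag_point_def triple_chart)
qed

lemma north_zigzag: "isgn (north \<bullet> vtx W i) = isgn (Y (i mod n))"
  using V_norm_pos(2) unfolding vtx_zigzag by (simp add: zigzag_point_def north_chart isgn_mult)

lemma sum_of_bool_upto:
  fixes k :: int
  assumes "\<And>j. P j \<Longrightarrow> 0 \<le> j \<and> j < k"
  shows "(\<Sum>j\<in>{0..k - 1}. of_bool (P j) :: int) = int (card {j. P j})"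
proof -
  have "{0..k - 1} \<inter> {j. P j} = {j. P j}" using assms by auto
  then show ?thesis by (simp add: sum_of_bool_eq)
qed

lemma Y_pos_iff: "0 \<le> j \<Longrightarrow> j < n \<Longrightarrow> Y j > 0 \<longleftrightarrow> (even j \<longleftrightarrow> j \<le> 2 * p + 1)"
  using Y_signs[of j] by (cases "even j"; cases "j \<le> 2 * p + 1") auto

lemma zigzag_critical_index: "critical_index W north = - p - q"
proof -
  have pos: "north \<bullet> vtx W i > 0 \<longleftrightarrow> Y (i mod n) > 0" for i
    using north_zigzag[of i] by (auto simp: isgn_if split: if_splits)
  \<comment> \<open>Vertex 0 is no up-crossing, since its predecessor \<open>n - 1\<close> lies
    above too; this leaves \<open>p\<close> even indices and \<open>q + 1\<close> odd ones.\<close>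
  have "of_bool (north \<bullet> vtx W j > 0 \<and> \<not> north \<bullet> vtx W (j - 1) > 0)
      = (of_bool (even j \<and> 2 * 0 < j \<and> j < 2 * (p + 1)) + of_bool (odd j \<and> 2 * (p + 1) < j \<and> j < 2 * (p + q + 2)) :: int)"
    if "j \<in> {0..n - 1}" for j
  proof -
    have j: "j mod n = j" "0 \<le> j" "j < n" using that by (auto intro: mod_pos_pos_trivial)
    have pj: "Y (prv j) > 0 \<longleftrightarrow> (even (prv j) \<longleftrightarrow> prv j \<le> 2 * p + 1)"
      by (rule Y_pos_iff) (use j p0 q0 in auto)
    show ?thesis
      unfolding pos mod_neighbours j(1) pj Y_pos_iff[OF j(2,3)]
      using j p0 q0 by (cases "j = 0"; cases "even j") auto
  qed
  then have "(\<Sum>j\<in>{0..n - 1}. of_bool (north \<bullet> vtx W j > 0 \<and> \<not> north \<bullet> vtx W (j - 1) > 0))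
     = (\<Sum>j\<in>{0..n - 1}. of_bool (even j \<and> 2 * 0 < j \<and> j < 2 * (p + 1)) :: int)
       + (\<Sum>j\<in>{0..n - 1}. of_bool (odd j \<and> 2 * (p + 1) < j \<and> j < 2 * (p + q + 2)))"
    unfolding sum.distrib[symmetric] by (intro sum.cong refl)
  also have "\<dots> = int (card {j. even j \<and> 2 * 0 < j \<and> j < 2 * (p + 1)})
      + int (card {j. odd j \<and> 2 * (p + 1) < j \<and> j < 2 * (p + q + 2)})"
    using p0 q0 by (intro arg_cong2[where f = "(+)"] sum_of_bool_upto) auto
  also have "\<dots> = p + q + 1"
    unfolding card_odd_between card_even_between using p0 q0 by simp
  finally show ?thesis unfolding critical_index_eq length_zigzag by simp
qed

lemma Y_next_neq:
  assumes "0 \<le> j" "j < n"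
  shows "Y j \<noteq> Y (nxt j)"
  using assms
proof (cases rule: index_cases)
  case 1
  then show ?thesis using Y_signs(1)[of 0] Y_signs(2)[of 1] p0 q0 by auto
next
  case 2
  then have "nxt j = j + 1" using q0 by auto
  then show ?thesis
    using Y_signs(1,2)[of j] Y_signs(1,2)[of "j + 1"] 2 q0 by (cases "even j") auto
next
  case 3
  then have "nxt j = 2 * p + 2" using q0 by auto
  then show ?thesis using Y_special 3 by simp
next
  case 4
  then have ne: "nxt j = 2 * p + 3" using q0 by auto
  have "Y (2 * p + 3) \<ge> 1" using Y_signs(4)[of "2 * p + 3"] p0 q0 by simp
  then show ?thesis unfolding ne unfolding 4 Y_special by simp
next
  case 5
  then have "nxt j = j + 1" by auto
  then show ?thesis
    using Y_signs(3,4)[of j] Y_signs(3,4)[of "j + 1"] 5 p0 by (cases "even j") auto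
next
  case 6
  then have "nxt j = 0" by auto
  then show ?thesis using Y_special 6 by simp
qed

lemma W_nonempty: "W \<noteq> []"
  using length_zigzag p0 q0 by auto

lemma zigzag_bend': "triple (vtx W i) (vtx W (i + 1)) (vtx W (i + 2)) \<noteq> 0"
  using zigzag_bend[of "i + 1"] by (simp add: add.assoc)

lemma zigzag_spherical: "spherical_polygon W" "spherical_polygon (polar_polygon W)"
proof -
  have "set W \<subseteq> sphere 0 1"
    using V_norm_pos by (auto simp: zigzag_def)
  then show "spherical_polygon W" "spherical_polygon (polar_polygon W)"
    using spherical_polygon_bend[OF _ _ zigzag_bend'] length_zigzag p0 q0 by auto
qed

lemma zigzag_admissible: "admissible W north"
proof -
  have "Y (i mod n) \<noteq> 0" for i
    using Y_signs[OF range_mod, of i] by (cases "even (i mod n)"; cases "i mod n \<le> 2 * p + 1") auto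
  then have "north \<bullet> vtx W i \<noteq> 0" for i
    using north_zigzag[of i] by (auto simp: isgn_nonzero split: if_splits)
  then show ?thesis by (simp add: admissible_def)
qed

lemma zigzag_normal_degree: "normal_degree W north = q - p"
proof -
  have D: "triple (vtx W i) (vtx W (i + 1)) (north \<times> front) \<noteq> 0" for i
    using Y_next_neq[OF range_mod, of i] V_norm_pos unfolding vtx_zigzag mod_neighbours
    by (simp add: zigzag_point_def triple_chart_axis del: if_split)
  have "normal_degree W north = (\<Sum>j\<in>{0..n - 1}. contribution j)"
    unfolding normal_degree_eq[OF W_nonempty zigzag_bend' north_front(1) zigzag_admissible north_front(2,3) D]
      length_zigzag
  proof (intro sum.cong refl)
    fix j assume "j \<in> {0..n - 1}"
    then have "j mod n = j" by (auto intro: mod_pos_pos_trivial)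
    then show "crossing_term north (north \<times> front) (vtx W (j - 1)) (vtx W j) (vtx W (j + 1)) = contribution j"
      unfolding vtx_zigzag mod_neighbours by (simp only: crossing_term_scale V_norm_pos)
  qed
  also have "\<dots> = (\<Sum>j\<in>{0..n - 1}. of_bool (odd j \<and> 2 * (p + 1) < j \<and> j < 2 * (p + q + 1))
      - of_bool (odd j \<and> 2 * 0 < j \<and> j < 2 * p))"
  proof (intro sum.cong refl)
    fix j assume j: "j \<in> {0..n - 1}"
    have "odd j \<and> 2 * p + 2 < j \<and> j < n - 1 \<longleftrightarrow> odd j \<and> 2 * (p + 1) < j \<and> j < 2 * (p + q + 1)"
      "odd j \<and> j \<le> 2 * p \<longleftrightarrow> odd j \<and> 2 * 0 < j \<and> j < 2 * p"
      by presburger (use j in presburger)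
    then show "contribution j = of_bool (odd j \<and> 2 * (p + 1) < j \<and> j < 2 * (p + q + 1)) - of_bool (odd j \<and> 2 * 0 < j \<and> j < 2 * p)"
      using crossing_term_zigzag[of j] j by simp
  qed
  also have "\<dots> = int (card {j. odd j \<and> 2 * (p + 1) < j \<and> j < 2 * (p + q + 1)}) - int (card {j. odd j \<and> 2 * 0 < j \<and> j < 2 * p})"
    unfolding sum_subtractf using p0 q0
    by (intro arg_cong2[where f = "(-)"] sum_of_bool_upto) auto
  also have "\<dots> = q - p"
    unfolding card_odd_between using p0 q0 by simp
  finally show ?thesis .
qed

text \<open>The half-open edges of the polygon lie in pairwise disjoint regions of the chart: unit-width vertical
  strips for the two zigzags, and the parts below and above them for the two long edges.\<close>

definition region :: "int \<Rightarrow> real \<Rightarrow> real \<Rightarrow> bool" where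
  "region j x y \<longleftrightarrow>
    (if j \<le> 2 * p then of_int j \<le> x \<and> x < of_int j + 1 \<and> y > -2
     else if j = 2 * p + 1 then x > -1 \<and> y \<le> -2
     else if j < n - 1 then of_int (2 * p - j) < x \<and> x \<le> of_int (2 * p + 1 - j) \<and> y < 2
     else x < 0 \<and> y \<ge> 2)"

lemma region_unique:
  assumes "0 \<le> i" "i < n" "0 \<le> j" "j < n" "region i x y" "region j x y"
  shows "i = j"
proof -
  have i: "of_int i \<ge> (0::real)" "of_int j \<ge> (0::real)" using assms by simp_all
  show ?thesis
    using assms i unfolding region_def by (auto split: if_splits)
qed

lemma region_edge:
  assumes j: "0 \<le> j" "j < n" and t: "0 \<le> t" "t < 1"
  shows "region j ((1 - t) * X j + t * X (nxt j)) ((1 - t) * Y j + t * Y (nxt j))"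
proof -
  have lower: "(1 - t) * a + t * b \<le> (1 - t) * Y j + t * Y (nxt j)" if "a \<le> Y j" "b \<le> Y (nxt j)" for a b
    using that t by (intro add_mono mult_left_mono) auto
  have upper: "(1 - t) * Y j + t * Y (nxt j) \<le> (1 - t) * a + t * b" if "Y j \<le> a" "Y (nxt j) \<le> b" for a b
    using that t by (intro add_mono mult_left_mono) auto
  consider "j \<le> 2 * p" | "j = 2 * p + 1" | "2 * p + 2 \<le> j" "j < n - 1" | "j = n - 1"
    using j by linarith
  then show ?thesis
  proof cases
    case 1
    have ne: "nxt j = j + 1" using 1 q0 by auto
    \<comment> \<open>Height -2 occurs only at the end point of the edge \<open>2 * p\<close>, which
      \<open>t < 1\<close> excludes.\<close>
    have "-1 \<le> Y j" "-2 \<le> Y (nxt j)" unfolding ne using 1 j q0 by (auto simp: zigzag_y_def)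
    from lower[OF this] have "(1 - t) * Y j + t * Y (nxt j) > -2" using t by (simp add: algebra_simps)
    then show ?thesis using 1 t unfolding ne by (simp add: region_def zigzag_x_def algebra_simps)
  next
    case 2
    have ne: "nxt j = 2 * p + 2" using 2 q0 by auto
    have "(1 - t) * (2 * of_int p + 1) \<ge> 0" using t p0 by simp
    then have "(1 - t) * X j + t * X (nxt j) > -1" unfolding ne using 2 t by (simp add: zigzag_x_def)
    moreover have "Y j = -2" "Y (nxt j) = -3" using Y_special(2,3) ne 2 by (simp_all only:)
    then have "(1 - t) * Y j + t * Y (nxt j) \<le> -2" using t by simp
    ultimately show ?thesis unfolding region_def using 2 by simp
  next
    case 3
    have ne: "nxt j = j + 1" using 3 by auto
    have "Y j \<le> 1" "Y (nxt j) \<le> 2" unfolding ne using 3 j q0 p0 by (auto simp: zigzag_y_def)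
    from upper[OF this] have "(1 - t) * Y j + t * Y (nxt j) < 2" using t by (simp add: algebra_simps)
    then show ?thesis using 3 t unfolding ne by (simp add: region_def zigzag_x_def algebra_simps)
  next
    case 4
    have ne: "nxt j = 0" using 4 by auto
    have "X j = - 2 * of_int q - 2" "X 0 = 0" using 4 p0 q0 by (auto simp: zigzag_x_def)
    then have "(1 - t) * X j + t * X (nxt j) < 0" unfolding ne using t q0 by (simp add: mult_pos_neg)
    moreover have "Y j = 2" "Y (nxt j) = 3" using Y_special(1,4) ne 4 by (simp_all only:)
    then have "(1 - t) * Y j + t * Y (nxt j) \<ge> 2" using t by simp
    ultimately show ?thesis unfolding region_def using 4 p0 q0 by simp
  qed
qed

lemma zigzag_simple: "simple_polygon W"
  unfolding simple_polygon_def length_zigzag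
proof (intro ballI impI equals0I)
  fix i j x
  assume ij: "i \<in> {0..<n}" "j \<in> {0..<n}" "i \<noteq> j"
    and x: "x \<in> (great_arc (vtx W i) (vtx W (i + 1)) - {vtx W (i + 1)}) \<inter> (great_arc (vtx W j) (vtx W (j + 1)) - {vtx W (j + 1)})"
  have R: "region k (x $ 2 / x $ 1) (x $ 3 / x $ 1)"
    if k: "k \<in> {0..<n}" and xk: "x \<in> great_arc (vtx W k) (vtx W (k + 1)) - {vtx W (k + 1)}" for k
  proof -
    have kn: "k mod n = k" using k by (auto intro: mod_pos_pos_trivial)
    have V1: "V l $ 1 = 1" "V l $ 2 = X l" "V l $ 3 = Y l" for l by (simp_all add: zigzag_point_def)
    have "\<exists>t. 0 \<le> t \<and> t < 1 \<and> (\<forall>m. x $ m / x $ 1 = (1 - t) * V k $ m + t * V (nxt k) $ m)"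
      using xk unfolding vtx_zigzag mod_neighbours kn by (intro great_arc_chart V1) (simp_all del: if_split)
    then obtain t where "0 \<le> t" "t < 1" "x $ 2 / x $ 1 = (1 - t) * X k + t * X (nxt k)"
        "x $ 3 / x $ 1 = (1 - t) * Y k + t * Y (nxt k)"
      unfolding V1[symmetric] by blast
    then show ?thesis using region_edge[of k t] k by simp
  qed
  show False
    using region_unique[of i j] R[of i] R[of j] ij x by auto
qed

end

theorem proposition29:
  shows "(\<forall>W \<xi>. spherical_polygon W \<and> simple_polygon W \<and> general_position W \<and>
              \<xi> \<in> sphere 0 1 \<and> admissible W \<xi> \<longrightarrow>
            \<bar>normal_degree W \<xi>\<bar> \<le> \<bar>critical_index W \<xi>\<bar> \<and>
            even (normal_degree W \<xi> - critical_index W \<xi>)) \<and>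
         (\<forall>i d :: int. i < 1 \<and> \<bar>i\<bar> \<ge> \<bar>d\<bar> \<and> even (d - i) \<longrightarrow>
            (\<exists>W \<xi>. spherical_polygon W \<and> simple_polygon W \<and> spherical_polygon (polar_polygon W) \<and>
              \<xi> \<in> sphere 0 1 \<and> admissible W \<xi> \<and>
              critical_index W \<xi> = i \<and> normal_degree W \<xi> = d))"
proof (intro conjI allI impI)
  fix i d :: int assume a: "i < 1 \<and> \<bar>i\<bar> \<ge> \<bar>d\<bar> \<and> even (d - i)"
  then obtain q where q: "d - i = 2 * q" by (elim conjE evenE)
  \<comment> \<open>The solution of \<open>p + q = - i\<close> and \<open>q - p = d\<close>; both
    numbers are nonnegative because the absolute value of \<open>d\<close> is at most
    \<open>- i\<close>.\<close>
  define p where "p = q - d"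
  have pq: "0 \<le> p" "0 \<le> q" "- p - q = i" "q - p = d" using a q by (auto simp: p_def)
  interpret zigzag_polygon p q by unfold_locales (use pq in auto)
  show "\<exists>W \<xi>. spherical_polygon W \<and> simple_polygon W \<and> spherical_polygon (polar_polygon W) \<and>
      \<xi> \<in> sphere 0 1 \<and> admissible W \<xi> \<and> critical_index W \<xi> = i \<and> normal_degree W \<xi> = d"
    using zigzag_spherical zigzag_simple north_front(1) zigzag_admissible zigzag_critical_index
      zigzag_normal_degree pq(3,4)
    by (intro exI[of _ "zigzag p q"] exI[of _ "north"]) simp
qed (use normal_degree_bound in blast)+

end
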